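(* For any finite sequence of nonnegative integers $p_k$, $k\ge7$, there exists a Pogorelov polytope whose number of $k$-gonal facets is $p_k$ for every $k\geq 7$.
   Context: All polytopes are convex; a $3$-polytope is simple if exactly three facets meet at each vertex. A simple polytope is flag if every collection of pairwise intersecting facets has nonempty intersection. A $k$-belt ($k\ge3$) in a simple $3$-polytope is a cyclic sequence of $k$ facets in which consecutive facets are adjacent, other pairs of facets do not intersect, and no three facets have a common vertex. A Pogorelov polytope is a simple flag $3$-polytope without $4$-belts (equivalently, a simple $3$-polytope different from the tetrahedron, without $3$-belts and $4$-belts). A finite sequence $p_k$, $k\ge 7$, means that $p_k=0$ for all but finitely many $k$; no condition is imposed on the numbers of $k$-gonal facets with $k\le6$. *)

theory Defs
  imports "HOL-Analysis.Analysis"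
begin

definition simple_3_polytope :: "(real^3) set \<Rightarrow> bool" where
  "simple_3_polytope P \<longleftrightarrow> polytope P \<and> aff_dim P = 3 \<and>
     (\<forall>v. v extreme_point_of P \<longrightarrow> card {F. F facet_of P \<and> v \<in> F} = 3)"

definition flag :: "(real^3) set \<Rightarrow> bool" where
  "flag P \<longleftrightarrow> (\<forall>C. C \<subseteq> {F. F facet_of P} \<and> (\<forall>F\<in>C. \<forall>G\<in>C. F \<inter> G \<noteq> {}) \<longrightarrow> \<Inter>C \<noteq> {})"

definition adjacent_facets :: "(real^3) set \<Rightarrow> (real^3) set \<Rightarrow> (real^3) set \<Rightarrow> bool" where
  "adjacent_facets P F G \<longleftrightarrow> F facet_of P \<and> G facet_of P \<and> F \<noteq> G \<and> (F \<inter> G) edge_of P"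

text \<open>The cyclic sequence is represented by a list with indices read modulo \<open>k\<close>. For
  \<open>k = 3\<close> all pairs are consecutive, and the last clause excludes three facets around a vertex.\<close>

definition belt :: "nat \<Rightarrow> (real^3) set \<Rightarrow> (real^3) set list \<Rightarrow> bool" where
  "belt k P Fs \<longleftrightarrow> k \<ge> 3 \<and> length Fs = k \<and> distinct Fs \<and> (\<forall>F\<in>set Fs. F facet_of P) \<and>
     (\<forall>i<k. adjacent_facets P (Fs ! i) (Fs ! (Suc i mod k))) \<and>
     (\<forall>i<k. \<forall>j<k. i \<noteq> j \<and> j \<noteq> Suc i mod k \<and> i \<noteq> Suc j mod k \<longrightarrow> Fs ! i \<inter> Fs ! j = {}) \<and>
     (\<forall>F\<in>set Fs. \<forall>G\<in>set Fs. \<forall>H\<in>set Fs. F \<noteq> G \<and> G \<noteq> H \<and> F \<noteq> H \<longrightarrow>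
        \<not> (\<exists>v. v extreme_point_of P \<and> v \<in> F \<inter> G \<inter> H))"

definition pogorelov_polytope :: "(real^3) set \<Rightarrow> bool" where
  "pogorelov_polytope P \<longleftrightarrow> simple_3_polytope P \<and> flag P \<and> \<not> (\<exists>Fs. belt 4 P Fs)"

definition k_gonal_facets :: "nat \<Rightarrow> (real^3) set \<Rightarrow> (real^3) set set" where
  "k_gonal_facets k P = {F. F facet_of P \<and> card {v. v extreme_point_of F} = k}"

end

theory Submission
  imports Defs
begin

text \<open>
  Let \<open>k\<^sub>1, \<dots>, k\<^sub>n\<close> be the prescribed facet sizes. Take the \<open>M\<close>-barrel (two \<open>M\<close>-gons joined by two rings
  of \<open>M\<close> pentagons) with \<open>M = 6 + \<Sum> (k\<^sub>i - 4)\<close>. Cutting off \<open>s\<close> consecutive edges of an \<open>m\<close>-gonal facet by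
  a plane, where \<open>2 \<le> s \<le> m - 4\<close>, keeps a polytope Pogorelov: it creates an \<open>(s + 3)\<close>-gon, turns the
  \<open>m\<close>-gon into an \<open>(m - s + 1)\<close>-gon, and gives one more side to each of the two facets at the ends of
  the cut. By parallel cuts that end in pentagons, the top \<open>M\<close>-gon is divided into a strip consisting
  of \<open>k\<^sub>i\<close>-gons and two pentagons, and the bottom \<open>M\<close>-gon into a strip of hexagons and pentagons. Each
  pentagon of the rings is hit at most once, so that all other facets are pentagons or hexagons.

  A polytope is handled through its vertex-facet incidences together with points realizing them.
  A realization determines the polytope, because by the simplex argument it is the convex hull of
  the listed vertices as soon as every edge at a listed vertex leads to another one.
\<close>

subsection \<open>Combinatorial types and their realizations\<close>

text \<open>A cut also enlarges the two facets at its ends, so the prescribed sizes cannot be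
  produced independently of each other. The pentagons of the rings absorb this effect: hit once, a
  pentagon becomes a hexagon, and the numbers of facets with at most 6 sides are free. The bounds on
  \<open>s\<close> keep quadrilaterals away, which would be surrounded by 4-belts:
  \<open>s = 1\<close> would create one, and \<open>s = m - 3\<close> would leave one behind. A
  \<open>k\<close>-gon arises from \<open>s = k - 3\<close> and costs the base \<open>k - 4\<close>
  sides. The strip opens with a pentagon, at the cost of one side, and what remains of the base is a
  pentagon as well; this gives \<open>M = 6 + \<Sum> (k\<^sub>i - 4)\<close>. The bottom base must
  not survive as an \<open>M\<close>-gon. Hexagons consume its sides in pairs, so the parity of
  \<open>M\<close> decides whether a pentagon or a hexagon remains. The geometry of a cut is mild:
  the plane of the facet is tilted slightly about a line through inner points of two of its
  edges.\<close>

definition adj :: "nat set set \<Rightarrow> nat \<Rightarrow> nat \<Rightarrow> bool" where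
  "adj T i j \<longleftrightarrow> i \<noteq> j \<and> (\<exists>t\<in>T. i \<in> t \<and> j \<in> t)"

definition deg :: "nat set set \<Rightarrow> nat \<Rightarrow> nat" where
  "deg T i = card {t \<in> T. i \<in> t}"

text \<open>A simple polytope is encoded by the set \<open>T\<close> of its vertices, each vertex being the set of
  the (labels of the) three facets through it. In the last clause one direction excludes 4-belts
  and the other excludes four pairwise adjacent facets.\<close>

definition pogorelov_complex :: "nat set set \<Rightarrow> bool" where
  "pogorelov_complex T \<longleftrightarrow> finite T \<and> T \<noteq> {} \<and> (\<forall>t\<in>T. card t = 3) \<and>
     (\<forall>t\<in>T. \<forall>i\<in>t. \<exists>t'\<in>T. t \<inter> t' = t - {i}) \<and>
     (\<forall>i j k. adj T i j \<and> adj T j k \<and> adj T i k \<longrightarrow> {i, j, k} \<in> T) \<and>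
     (\<forall>a b c d. adj T a b \<and> adj T b c \<and> adj T c d \<and> adj T d a \<and> a \<noteq> c \<and> b \<noteq> d \<longrightarrow>
        (adj T a c \<longleftrightarrow> \<not> adj T b d))"

text \<open>The conditions speak of the listed vertices only, so they can be checked vertex by
  vertex after a cut. That the half-spaces have no further common points outside the hull of these
  vertices is derived from the edge clause.\<close>

definition realizable :: "nat set set \<Rightarrow> bool" where
  "realizable T \<longleftrightarrow> (\<exists>(a :: nat \<Rightarrow> real^3) b. \<forall>t\<in>T. \<exists>x. \<forall>i\<in>\<Union>T.
     a i \<bullet> x \<le> b i \<and> (a i \<bullet> x = b i \<longleftrightarrow> i \<in> t))"

lemma adjI: "t \<in> T \<Longrightarrow> i \<in> t \<Longrightarrow> j \<in> t \<Longrightarrow> i \<noteq> j \<Longrightarrow> adj T i j"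
  unfolding adj_def by blast

lemma adj_sym: "adj T i j \<longleftrightarrow> adj T j i"
  by (auto simp: adj_def)

lemma adj_irrefl [simp]: "\<not> adj T i i"
  by (simp add: adj_def)

lemma
  assumes "pogorelov_complex T"
  shows pog_finite: "finite T"
    and pog_nonempty: "T \<noteq> {}"
    and pog_card: "\<And>t. t \<in> T \<Longrightarrow> card t = 3"
    and pog_edge: "\<And>t i. t \<in> T \<Longrightarrow> i \<in> t \<Longrightarrow> \<exists>t'\<in>T. t \<inter> t' = t - {i}"
    and pog_triangle: "\<And>i j k. adj T i j \<Longrightarrow> adj T j k \<Longrightarrow> adj T i k \<Longrightarrow> {i, j, k} \<in> T"
    and pog_square: "\<And>a b c d. adj T a b \<Longrightarrow> adj T b c \<Longrightarrow> adj T c d \<Longrightarrow> adj T d a \<Longrightarrow>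
      a \<noteq> c \<Longrightarrow> b \<noteq> d \<Longrightarrow> adj T a c \<longleftrightarrow> \<not> adj T b d"
  using assms unfolding pogorelov_complex_def by blast+

section \<open>Geometry of a realized complex\<close>

locale realization =
  fixes T :: "nat set set" and a :: "nat \<Rightarrow> real^3" and b :: "nat \<Rightarrow> real" and p :: "nat set \<Rightarrow> real^3"
  assumes fin: "finite T" and ne: "T \<noteq> {}" and card3: "t \<in> T \<Longrightarrow> card t = 3"
    and edge: "t \<in> T \<Longrightarrow> i \<in> t \<Longrightarrow> \<exists>t'\<in>T. t \<inter> t' = t - {i}"
    and le: "t \<in> T \<Longrightarrow> i \<in> \<Union>T \<Longrightarrow> a i \<bullet> p t \<le> b i"
    and tight: "t \<in> T \<Longrightarrow> i \<in> \<Union>T \<Longrightarrow> a i \<bullet> p t = b i \<longleftrightarrow> i \<in> t"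
begin

definition P :: "(real^3) set" where
  "P = {x. \<forall>i\<in>\<Union>T. a i \<bullet> x \<le> b i}"

definition Fc :: "nat \<Rightarrow> (real^3) set" where
  "Fc i = P \<inter> {x. a i \<bullet> x = b i}"

lemma fin_t: "t \<in> T \<Longrightarrow> finite t"
  using card3 by (metis card.infinite zero_neq_numeral)

lemma fin_I: "finite (\<Union>T)"
  using fin fin_t by blast

lemma convex_P: "convex P"
proof -
  have "P = (\<Inter>i\<in>\<Union>T. {x. a i \<bullet> x \<le> b i})" by (auto simp: P_def)
  also have "convex \<dots>" by (intro convex_INT convex_halfspace_le)
  finally show ?thesis .
qed

lemma p_in_P: "t \<in> T \<Longrightarrow> p t \<in> P"
  using le by (auto simp: P_def)

lemma p_in_Fc: "t \<in> T \<Longrightarrow> i \<in> \<Union>T \<Longrightarrow> p t \<in> Fc i \<longleftrightarrow> i \<in> t"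
  using tight p_in_P by (auto simp: Fc_def)

lemma inj_p: "inj_on p T"
proof (rule inj_onI)
  fix t u assume h: "t \<in> T" "u \<in> T" "p t = p u"
  have "i \<in> t \<longleftrightarrow> i \<in> u" if "i \<in> \<Union>T" for i
    using tight[OF h(1) that] tight[OF h(2) that] h(3) by simp
  then show "t = u" using h(1,2) by blast
qed

text \<open>All terms but one are orthogonal to \<open>a j\<close>, so pairing with
  \<open>a j\<close> reads off the coordinate of index \<open>j\<close>.\<close>

lemma frame_coef:
  assumes "finite t" "j \<in> t" "\<And>i. i \<in> t \<Longrightarrow> i \<noteq> j \<Longrightarrow> a j \<bullet> w i = 0"
  shows "a j \<bullet> (\<Sum>i\<in>t. u i *\<^sub>R w i) = u j * (a j \<bullet> w j)"
proof -
  have "a j \<bullet> (\<Sum>i\<in>t. u i *\<^sub>R w i) = (\<Sum>i\<in>t. if i = j then u j * (a j \<bullet> w j) else 0)"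
    unfolding inner_sum_right using assms by (intro sum.cong) auto
  then show ?thesis using assms by simp
qed

text \<open>The edge directions at a vertex form a basis dual, up to sign, to the normals of the
  facets through it.\<close>

lemma edge_frame:
  assumes t: "t \<in> T"
  obtains w where "\<And>i. i \<in> t \<Longrightarrow> p t + w i \<in> p ` T"
    and "\<And>i j. i \<in> t \<Longrightarrow> j \<in> t \<Longrightarrow> i \<noteq> j \<Longrightarrow> a j \<bullet> w i = 0"
    and "\<And>i. i \<in> t \<Longrightarrow> a i \<bullet> w i < 0"
    and "inj_on w t" and "independent (w ` t)"
    and "\<And>x. \<exists>u. x = (\<Sum>i\<in>t. u i *\<^sub>R w i)"
proof -
  have "\<forall>i\<in>t. \<exists>t'. t' \<in> T \<and> t \<inter> t' = t - {i}"
    using edge[OF t] by blast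
  then obtain n where n: "\<And>i. i \<in> t \<Longrightarrow> n i \<in> T" "\<And>i. i \<in> t \<Longrightarrow> t \<inter> n i = t - {i}"
    by metis
  define w where "w i = p (n i) - p t" for i
  have sub: "j \<in> \<Union>T" if "j \<in> t" for j using t that by blast
  have 1: "p t + w i \<in> p ` T" if "i \<in> t" for i
    using n(1)[OF that] by (simp add: w_def)
  have 2: "a j \<bullet> w i = 0" if "i \<in> t" "j \<in> t" "i \<noteq> j" for i j
  proof -
    have "j \<in> n i" using n(2)[OF that(1)] that by blast
    then show ?thesis
      using tight[OF n(1)[OF that(1)] sub[OF that(2)]] tight[OF t sub[OF that(2)]] that
      by (simp add: w_def inner_diff_right)
  qed
  have 3: "a i \<bullet> w i < 0" if "i \<in> t" for i
  proof -
    have "i \<notin> n i" using n(2)[OF that] that by blast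
    then show ?thesis
      using tight[OF n(1)[OF that] sub[OF that]] le[OF n(1)[OF that] sub[OF that]]
        tight[OF t sub[OF that]] that
      by (simp add: w_def inner_diff_right)
  qed
  have 4: "inj_on w t"
    by (rule inj_onI) (metis 2 3 less_irrefl)
  have finw: "finite (w ` t)" using fin_t[OF t] by simp
  have coef: "a j \<bullet> (\<Sum>i\<in>t. u i *\<^sub>R w i) = u j * (a j \<bullet> w j)" if "j \<in> t" for u j
    using frame_coef[OF fin_t[OF t] that] 2 that by simp
  have 5: "independent (w ` t)"
  proof
    assume "dependent (w ` t)"
    then obtain u v where u: "v \<in> w ` t" "u v \<noteq> 0" "(\<Sum>v\<in>w ` t. u v *\<^sub>R v) = 0"
      using dependent_finite[OF finw] by auto
    from u(1) obtain j where j: "j \<in> t" "v = w j" by blast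
    have "(\<Sum>i\<in>t. u (w i) *\<^sub>R w i) = 0"
      using u(3) 4 by (simp add: sum.reindex)
    then have "u (w j) * (a j \<bullet> w j) = 0"
      using coef[OF j(1), of "\<lambda>i. u (w i)"] by simp
    then show False using 3[OF j(1)] u(2) j(2) by simp
  qed
  have "card (w ` t) = 3" using card_image[OF 4] card3[OF t] by simp
  then have sp: "span (w ` t) = UNIV"
    using card_ge_dim_independent[of "w ` t" UNIV] 5 by auto
  have 6: "\<exists>u. x = (\<Sum>i\<in>t. u i *\<^sub>R w i)" for x
  proof -
    have "x \<in> span (w ` t)" using sp by simp
    then obtain u where "x = (\<Sum>v\<in>w ` t. u v *\<^sub>R v)"
      using span_finite[OF finw] by auto
    then have "x = (\<Sum>i\<in>t. u (w i) *\<^sub>R w i)" using 4 by (simp add: sum.reindex)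
    then show ?thesis by (rule exI[of _ "\<lambda>i. u (w i)"])
  qed
  show thesis by (rule that[OF 1 2 3 4 5 6])
qed

text \<open>A vertex whose three neighbours do not improve a linear functional maximises it on \<open>P\<close>,
  so no hyperplane separates a point of \<open>P\<close> from the listed vertices.\<close>

lemma P_eq_hull: "P = convex hull (p ` T)"
proof
  show "convex hull (p ` T) \<subseteq> P"
  proof (rule hull_minimal)
    show "p ` T \<subseteq> P" using p_in_P by blast
    show "convex P" by (rule convex_P)
  qed
  show "P \<subseteq> convex hull (p ` T)"
  proof (rule ccontr)
    assume "\<not> ?thesis"
    then obtain x where x: "x \<in> P" "x \<notin> convex hull (p ` T)" by blast
    have "closed (convex hull (p ` T))"
      using fin by (simp add: compact_imp_closed finite_imp_compact_convex_hull)
    then obtain c d where cd: "c \<bullet> x < d" "\<And>y. y \<in> convex hull (p ` T) \<Longrightarrow> c \<bullet> y > d"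
      using separating_hyperplane_closed_point[of "convex hull (p ` T)" x] x(2) by auto
    have "Min ((\<lambda>t. c \<bullet> p t) ` T) \<in> (\<lambda>t. c \<bullet> p t) ` T"
      using fin ne by (intro Min_in) auto
    then obtain t where t: "t \<in> T" and min: "Min ((\<lambda>t. c \<bullet> p t) ` T) = c \<bullet> p t" by blast
    have t2: "c \<bullet> p t \<le> c \<bullet> p u" if "u \<in> T" for u
      unfolding min[symmetric] using fin that by (intro Min_le) auto
    obtain w where w: "\<And>i. i \<in> t \<Longrightarrow> p t + w i \<in> p ` T"
      "\<And>i j. i \<in> t \<Longrightarrow> j \<in> t \<Longrightarrow> i \<noteq> j \<Longrightarrow> a j \<bullet> w i = 0"
      "\<And>i. i \<in> t \<Longrightarrow> a i \<bullet> w i < 0"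
      "inj_on w t" "independent (w ` t)"
      "\<And>x. \<exists>u. x = (\<Sum>i\<in>t. u i *\<^sub>R w i)"
      by (rule edge_frame[OF t], rule that)
    obtain u where u: "x - p t = (\<Sum>i\<in>t. u i *\<^sub>R w i)" using w(6) by blast
    \<comment> \<open>\<open>x\<close> lies in the cone spanned by the edges at \<open>t\<close>:
      \<open>a j\<close> is at most 0 on \<open>x - p t\<close> and negative on
      \<open>w j\<close>.\<close>
    have nonneg: "u j \<ge> 0" if j: "j \<in> t" for j
    proof -
      have jI: "j \<in> \<Union>T" using t j by blast
      have "a j \<bullet> (x - p t) \<le> 0"
        using x(1) jI tight[OF t jI] j by (auto simp: P_def inner_diff_right)
      then have "u j * (a j \<bullet> w j) \<le> 0"
        unfolding u using frame_coef[OF fin_t[OF t] j w(2)] j by simp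
      then show ?thesis using w(3)[OF j] by (simp add: mult_le_0_iff)
    qed
    have "c \<bullet> w i \<ge> 0" if i: "i \<in> t" for i
    proof -
      obtain v where "v \<in> T" "p t + w i = p v" using w(1)[OF i] by auto
      then show ?thesis using t2[of v] by (metis add_le_same_cancel1 inner_add_right le_add_same_cancel1)
    qed
    then have "c \<bullet> (x - p t) \<ge> 0"
      unfolding u inner_sum_right using nonneg by (intro sum_nonneg) simp
    moreover have "c \<bullet> p t > d" using cd(2) t by (simp add: hull_inc)
    ultimately show False using cd(1) by (simp add: inner_diff_right)
  qed
qed

lemma polytope_P: "polytope P"
  unfolding polytope_def using P_eq_hull fin by blast

text \<open>The edge that leaves facet \<open>i\<close> at one of its vertices ends at a vertex off
  \<open>i\<close>.\<close>

lemma avoid: 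
  assumes "i \<in> \<Union>T" shows "\<exists>t\<in>T. i \<notin> t"
  using assms edge by fastforce

lemma avoid_in:
  assumes "i \<in> \<Union>T" "i \<noteq> j" shows "\<exists>t\<in>T. i \<in> t \<and> j \<notin> t"
proof -
  obtain t where t: "t \<in> T" "i \<in> t" using assms by blast
  show ?thesis
  proof (cases "j \<in> t")
    case True
    then obtain t' where "t' \<in> T" "t \<inter> t' = t - {j}" using edge[OF t(1)] by blast
    then show ?thesis using t assms(2) True by blast
  qed (use t in blast)
qed

lemma interior_P: "interior P = {x. \<forall>i\<in>\<Union>T. a i \<bullet> x < b i}"
proof
  have "{x. \<forall>i\<in>\<Union>T. a i \<bullet> x < b i} = (\<Inter>i\<in>\<Union>T. {x. a i \<bullet> x < b i})" by auto
  also have "open \<dots>"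
    using fin_I by (intro open_INT ballI open_halfspace_lt)
  finally show "{x. \<forall>i\<in>\<Union>T. a i \<bullet> x < b i} \<subseteq> interior P"
    by (intro interior_maximal) (auto simp: P_def less_imp_le)
  show "interior P \<subseteq> {x. \<forall>i\<in>\<Union>T. a i \<bullet> x < b i}"
  proof (intro subsetI CollectI ballI)
    fix x i assume x: "x \<in> interior P" and i: "i \<in> \<Union>T"
    \<comment> \<open>With a zero normal the inequality would be tight at all vertices or at
      none.\<close>
    have nz: "a i \<noteq> 0"
    proof
      assume "a i = 0"
      moreover obtain t where "t \<in> T" "i \<in> t" using i by blast
      moreover obtain u where "u \<in> T" "i \<notin> u" using avoid[OF i] by blast
      ultimately show False using tight i by (metis inner_zero_left)
    qed
    have "interior P \<subseteq> interior {x. a i \<bullet> x \<le> b i}"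
      using i by (intro interior_mono) (auto simp: P_def)
    then show "a i \<bullet> x < b i" using x nz by auto
  qed
qed

lemma interior_nonempty: "interior P \<noteq> {}"
proof -
  let ?n = "real (card T)"
  \<comment> \<open>The barycentre of the vertices: an inequality valid at all of them and strict at
    one is strict here.\<close>
  define z where "z = (1 / ?n) *\<^sub>R (\<Sum>t\<in>T. p t)"
  have n: "?n > 0" using fin ne by (simp add: card_gt_0_iff)
  have "a i \<bullet> z < b i" if i: "i \<in> \<Union>T" for i
  proof -
    obtain u where u: "u \<in> T" "i \<notin> u" using avoid[OF i] by blast
    have "(\<Sum>t\<in>T. a i \<bullet> p t) < (\<Sum>t\<in>T. b i)"
      using fin le i u tight[OF u(1) i] by (intro sum_strict_mono_ex1) (auto simp: order_less_le)
    then show ?thesis using n by (simp add: z_def inner_sum_right field_simps)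
  qed
  then have "z \<in> interior P" unfolding interior_P by blast
  then show ?thesis by blast
qed

lemma aff_dim_P: "aff_dim P = 3"
  using aff_dim_nonempty_interior[OF interior_nonempty] by simp

lemma face_Fc: "i \<in> \<Union>T \<Longrightarrow> Fc i face_of P"
  unfolding Fc_def
  by (rule face_of_Int_supporting_hyperplane_le[OF convex_P]) (unfold P_def, blast)

lemma Fc_subset: "Fc i \<subseteq> P" by (auto simp: Fc_def)

text \<open>A vertex \<open>t\<close> on \<open>i\<close> and its neighbours along the two edges
  inside \<open>i\<close> are three affinely independent points of \<open>Fc i\<close>, so the
  dimension is at least 2. A vertex off \<open>i\<close> makes the face proper, so it is at most
  2.\<close>

lemma facet_Fc:
  assumes i: "i \<in> \<Union>T" shows "Fc i facet_of P"
proof -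
  obtain t where t: "t \<in> T" "i \<in> t" using i by blast
  obtain w where w: "\<And>i. i \<in> t \<Longrightarrow> p t + w i \<in> p ` T"
      "\<And>i j. i \<in> t \<Longrightarrow> j \<in> t \<Longrightarrow> i \<noteq> j \<Longrightarrow> a j \<bullet> w i = 0"
      "\<And>i. i \<in> t \<Longrightarrow> a i \<bullet> w i < 0"
      "inj_on w t" "independent (w ` t)"
      "\<And>x. \<exists>u. x = (\<Sum>i\<in>t. u i *\<^sub>R w i)"
      by (rule edge_frame[OF t(1)], rule that)
  define S where "S = (\<lambda>j. p t + w j) ` (t - {i})"
  have "p t + w j \<in> Fc i" if "j \<in> t - {i}" for j
  proof -
    have "p t + w j \<in> P" using w(1)[of j] that p_in_P by auto
    moreover have "a i \<bullet> (p t + w j) = b i"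
      using w(2)[of j i] that t tight[OF t(1) i] by (simp add: inner_add_right)
    ultimately show ?thesis by (simp add: Fc_def)
  qed
  then have S: "insert (p t) S \<subseteq> Fc i"
    using t p_in_Fc[OF t(1) i] by (auto simp: S_def)
  have im: "(\<lambda>x. - p t + x) ` S = w ` (t - {i})" by (force simp: S_def image_image)
  have nw: "0 \<notin> w ` t" using w(5) dependent_zero by blast
  then have nin: "p t \<notin> S" by (auto simp: S_def)
  have indep: "independent (w ` (t - {i}))"
    using w(5) by (rule independent_mono) blast
  then have "\<not> affine_dependent (insert (p t) S)"
    using affine_dependent_iff_dependent[OF nin] im by simp
  then have "int (card (insert (p t) S)) = aff_dim (insert (p t) S) + 1"
    by (rule aff_dim_affine_independent)
  moreover have "card S = 2"
  proof -
    have "inj_on (\<lambda>j. p t + w j) (t - {i})" using w(4) by (auto simp: inj_on_def)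
    then have "card S = card (t - {i})" unfolding S_def by (rule card_image)
    then show ?thesis using t card3 fin_t by simp
  qed
  moreover have "finite S" using fin_t[OF t(1)] by (simp add: S_def)
  ultimately have "aff_dim (Fc i) \<ge> 2"
    using aff_dim_subset[OF S] nin by simp
  moreover have "aff_dim (Fc i) < aff_dim P"
  proof (rule face_of_aff_dim_lt[OF polytope_imp_convex[OF polytope_P] face_Fc[OF i]])
    obtain u where u: "u \<in> T" "i \<notin> u" using avoid[OF i] by blast
    show "Fc i \<noteq> P" using u p_in_P p_in_Fc[OF u(1) i] by blast
  qed
  ultimately show ?thesis
    using aff_dim_P face_Fc[OF i] S by (auto simp: facet_of_def)
qed

text \<open>A relative interior point of a facet is a boundary point of \<open>P\<close>, so one of
  the inequalities is tight there. The face \<open>Fc i\<close> then contains the whole facet, and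
  equal dimensions make the two coincide.\<close>

lemma facets: "{F. F facet_of P} = Fc ` \<Union>T"
proof (intro equalityI subsetI)
  fix C assume "C \<in> {F. F facet_of P}"
  then have C: "C face_of P" "C \<noteq> {}" "aff_dim C = 2"
    using aff_dim_P by (auto simp: facet_of_def)
  have conv: "convex C" using C(1) by (rule face_of_imp_convex)
  obtain z where z: "z \<in> rel_interior C"
    using conv C(2) rel_interior_eq_empty by blast
  have "C \<noteq> P" using C(3) aff_dim_P by auto
  then have "C \<inter> interior P = {}" by (rule face_of_disjoint_interior[OF C(1)])
  moreover have zC: "z \<in> C" using z rel_interior_subset by blast
  moreover have zP: "z \<in> P" using zC C(1) face_of_imp_subset by blast
  ultimately have "z \<notin> interior P" by blast
  then obtain i where i: "i \<in> \<Union>T" "\<not> a i \<bullet> z < b i"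
    unfolding interior_P by blast
  with zP have "a i \<bullet> z = b i" unfolding P_def by (metis (lifting) mem_Collect_eq order_le_less)
  then have "z \<in> Fc i" using zP by (simp add: Fc_def)
  then have "C \<subseteq> Fc i"
    using subset_of_face_of[OF face_Fc[OF i(1)], of C] z C(1) face_of_imp_subset by blast
  then have "C face_of Fc i"
    using face_of_subset[OF C(1) _ Fc_subset] by blast
  moreover have "aff_dim (Fc i) = 2"
    using facet_Fc[OF i(1)] aff_dim_P by (auto simp: facet_of_def)
  ultimately have "C = Fc i"
    using face_of_aff_dim_lt[of "Fc i" C] C(3) face_of_imp_convex[OF face_Fc[OF i(1)]] by force
  then show "C \<in> Fc ` \<Union>T" using i(1) by blast
qed (use facet_Fc in blast)

lemma facet_iff: "F facet_of P \<longleftrightarrow> F \<in> Fc ` \<Union>T"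
  unfolding facets[symmetric] by simp

lemma inj_Fc: "inj_on Fc (\<Union>T)"
proof (rule inj_onI, rule ccontr)
  fix i j assume h: "i \<in> \<Union>T" "j \<in> \<Union>T" "Fc i = Fc j" "i \<noteq> j"
  obtain t where "t \<in> T" "i \<in> t" "j \<notin> t" using avoid_in[OF h(1,4)] by blast
  then show False using p_in_Fc h by metis
qed

text \<open>The facets through \<open>t\<close> meet in \<open>p t\<close> alone, because all
  coordinates along the edge directions vanish there, and an intersection of faces is a face. The
  converse is the description of \<open>P\<close> as a hull.\<close>

lemma extreme_P: "v extreme_point_of P \<longleftrightarrow> v \<in> p ` T"
proof
  assume "v extreme_point_of P"
  then show "v \<in> p ` T" unfolding P_eq_hull by (rule extreme_point_of_convex_hull)
next
  assume "v \<in> p ` T"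
  then obtain t where t: "t \<in> T" "v = p t" by blast
  obtain w where w: "\<And>i. i \<in> t \<Longrightarrow> p t + w i \<in> p ` T"
      "\<And>i j. i \<in> t \<Longrightarrow> j \<in> t \<Longrightarrow> i \<noteq> j \<Longrightarrow> a j \<bullet> w i = 0"
      "\<And>i. i \<in> t \<Longrightarrow> a i \<bullet> w i < 0"
      "inj_on w t" "independent (w ` t)"
      "\<And>x. \<exists>u. x = (\<Sum>i\<in>t. u i *\<^sub>R w i)"
      by (rule edge_frame[OF t(1)], rule that)
  have "t \<noteq> {}" using card3[OF t(1)] by auto
  have "\<Inter>(Fc ` t) = {v}"
  proof (intro equalityI subsetI)
    fix x assume x: "x \<in> \<Inter>(Fc ` t)"
    obtain u where u: "x - p t = (\<Sum>i\<in>t. u i *\<^sub>R w i)" using w(6) by blast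
    have "u j = 0" if j: "j \<in> t" for j
    proof -
      have "x \<in> Fc j" using x j by blast
      then have "a j \<bullet> x = b j" by (simp add: Fc_def)
      moreover have "a j \<bullet> p t = b j" using tight[OF t(1), of j] j t(1) by blast
      ultimately have "a j \<bullet> (x - p t) = 0" by (simp add: inner_diff_right)
      then have "u j * (a j \<bullet> w j) = 0"
        unfolding u using frame_coef[OF fin_t[OF t(1)] j w(2)] j by simp
      then show ?thesis using w(3)[OF j] by simp
    qed
    then have "x - p t = 0" using u by simp
    then show "x \<in> {v}" using t(2) by simp
  qed (use t p_in_Fc in auto)
  moreover have "\<Inter>(Fc ` t) face_of P"
    using \<open>t \<noteq> {}\<close> t(1) face_Fc by (intro face_of_Inter) auto
  ultimately show "v extreme_point_of P" by (simp add: face_of_singleton)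
qed

text \<open>A face is compact and convex, so it has an extreme point, which is then extreme in
  \<open>P\<close> and hence listed. Questions about intersections of facets thereby become
  questions about \<open>T\<close>.\<close>

lemma face_has_vertex:
  assumes "C face_of P" "C \<noteq> {}" shows "\<exists>t\<in>T. p t \<in> C"
proof -
  have "compact C" using face_of_imp_compact[OF polytope_imp_convex polytope_imp_compact assms(1)] polytope_P by blast
  then obtain x where "x extreme_point_of C"
    using extreme_point_exists_convex assms face_of_imp_convex by blast
  then show ?thesis
    using extreme_point_of_face[OF assms(1)] extreme_P by auto
qed

lemma Fc_meet:
  assumes "i \<in> \<Union>T" "j \<in> \<Union>T" "i \<noteq> j" shows "Fc i \<inter> Fc j \<noteq> {} \<longleftrightarrow> adj T i j"
proof
  assume "Fc i \<inter> Fc j \<noteq> {}"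
  then obtain t where "t \<in> T" "p t \<in> Fc i \<inter> Fc j"
    using face_has_vertex face_of_Int face_Fc assms by blast
  then show "adj T i j" using p_in_Fc assms by (auto simp: adj_def)
next
  assume "adj T i j"
  then obtain t where "t \<in> T" "i \<in> t" "j \<in> t" by (auto simp: adj_def)
  then show "Fc i \<inter> Fc j \<noteq> {}" using p_in_Fc assms by blast
qed

lemma simple: "simple_3_polytope P"
  unfolding simple_3_polytope_def
proof (intro conjI allI impI)
  fix v assume "v extreme_point_of P"
  then obtain t where t: "t \<in> T" "v = p t" using extreme_P by blast
  have "{F. F facet_of P \<and> v \<in> F} = Fc ` t"
    using facets p_in_Fc[OF t(1)] t by blast
  moreover have "inj_on Fc t" using inj_Fc t(1) by (meson Union_upper inj_on_subset)
  ultimately show "card {F. F facet_of P \<and> v \<in> F} = 3"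
    using card3[OF t(1)] by (simp add: card_image)
qed (use polytope_P aff_dim_P in auto)

lemma card_k_gonal: "card (k_gonal_facets k P) = card {i \<in> \<Union>T. deg T i = k}"
proof -
  have d: "card {v. v extreme_point_of (Fc i)} = deg T i" if "i \<in> \<Union>T" for i
  proof -
    have "{v. v extreme_point_of (Fc i)} = p ` {t \<in> T. i \<in> t}"
      using extreme_point_of_face[OF face_Fc[OF that]] extreme_P p_in_Fc[OF _ that] by auto
    moreover have "inj_on p {t \<in> T. i \<in> t}" using inj_p by (rule inj_on_subset) blast
    ultimately show ?thesis by (simp add: card_image deg_def)
  qed
  have "k_gonal_facets k P = Fc ` {i \<in> \<Union>T. deg T i = k}"
  proof -
    have "k_gonal_facets k P = {F \<in> Fc ` \<Union>T. card {v. v extreme_point_of F} = k}"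
      unfolding k_gonal_facets_def facet_iff by (rule refl)
    also have "\<dots> = Fc ` {i \<in> \<Union>T. card {v. v extreme_point_of (Fc i)} = k}" by blast
    also have "\<dots> = Fc ` {i \<in> \<Union>T. deg T i = k}"
      using d by (intro arg_cong[of _ _ "image Fc"] Collect_cong) metis
    finally show ?thesis .
  qed
  moreover have "inj_on Fc {i \<in> \<Union>T. deg T i = k}" using inj_Fc by (rule inj_on_subset) blast
  ultimately show ?thesis by (simp add: card_image)
qed

text \<open>The labels form a clique of \<open>adj T\<close>. A clique of at most three labels lies
  in a vertex, by \<open>pog_triangle\<close>; four pairwise adjacent facets would be a 4-cycle with
  both diagonals, which \<open>pog_square\<close> forbids. The empty family causes no trouble, as
  its labels lie in any vertex.\<close>

lemma flag_P:
  assumes pog: "pogorelov_complex T" shows "flag P"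
  unfolding flag_def
proof (intro allI impI)
  fix C assume C: "C \<subseteq> {F. F facet_of P} \<and> (\<forall>F\<in>C. \<forall>G\<in>C. F \<inter> G \<noteq> {})"
  then obtain J where J: "J \<subseteq> \<Union>T" "C = Fc ` J"
    using facets by (metis subset_imageE)
  have adjJ: "adj T i j" if "i \<in> J" "j \<in> J" "i \<noteq> j" for i j
  proof -
    have "Fc i \<inter> Fc j \<noteq> {}" using that C J(2) by simp
    then show ?thesis using Fc_meet[of i j] that J(1) by blast
  qed
  have "\<exists>t\<in>T. J \<subseteq> t"
  proof (rule ccontr)
    assume no: "\<not> ?thesis"
    obtain i where i: "i \<in> J" using no ne by fastforce
    obtain t where t: "t \<in> T" "i \<in> t" using i J(1) by blast
    obtain j where j: "j \<in> J" "j \<noteq> i" using no t by blast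
    obtain t where t: "t \<in> T" "i \<in> t" "j \<in> t" using adjJ[OF i j(1)] j by (auto simp: adj_def)
    obtain k where k: "k \<in> J" "k \<noteq> i" "k \<noteq> j" using no t by blast
    have "{i, j, k} \<in> T"
      by (rule pog_triangle[OF pog]) (use adjJ i j k in auto)
    then obtain l where l: "l \<in> J" "l \<notin> {i, j, k}" using no by blast
    show False
      using pog_square[OF pog, of i j k l] adjJ i j k l by auto
  qed
  then obtain t where t: "t \<in> T" "J \<subseteq> t" by blast
  then have "p t \<in> \<Inter>C" using J p_in_Fc by blast
  then show "\<Inter>C \<noteq> {}" by blast
qed

text \<open>The labels of a 4-belt form a 4-cycle without diagonals, whereas
  \<open>pog_square\<close> demands exactly one diagonal.\<close>

lemma no_4_belt:
  assumes pog: "pogorelov_complex T" shows "\<not> belt 4 P Fs"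
proof
  assume B: "belt 4 P Fs"
  note B = B[unfolded belt_def, THEN conjunct2]
  note len = B[THEN conjunct1]
  note B = B[THEN conjunct2]
  note dist = B[THEN conjunct1]
  note B = B[THEN conjunct2]
  note fac = B[THEN conjunct1]
  note B = B[THEN conjunct2]
  note cyc = B[THEN conjunct1]
  note opp = B[THEN conjunct2, THEN conjunct1]
  have "\<exists>i. i \<in> \<Union>T \<and> Fs ! k = Fc i" if "k < 4" for k
  proof -
    have "Fs ! k \<in> {F. F facet_of P}" using fac len that by (metis mem_Collect_eq nth_mem)
    then show ?thesis unfolding facets by blast
  qed
  then obtain q where q: "\<And>k. k < 4 \<Longrightarrow> q k \<in> \<Union>T" "\<And>k. k < 4 \<Longrightarrow> Fs ! k = Fc (q k)"
    by (metis (lifting))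
  have dq: "q k \<noteq> q l" if "k < 4" "l < 4" "k \<noteq> l" for k l
    using q(2)[OF that(1)] q(2)[OF that(2)] nth_eq_iff_index_eq[OF dist, of k l] that len by auto
  have ad: "adj T (q k) (q (Suc k mod 4))" if "k < 4" for k
  proof -
    have "adjacent_facets P (Fs ! k) (Fs ! (Suc k mod 4))" using cyc that by blast
    then have "Fs ! k \<inter> Fs ! (Suc k mod 4) \<noteq> {}" unfolding adjacent_facets_def edge_of_def by force
    moreover have "k \<noteq> Suc k mod 4" using that by presburger
    ultimately show ?thesis using Fc_meet[OF q(1) q(1) dq, of k "Suc k mod 4"] q(2) that by simp
  qed
  have nad: "\<not> adj T (q k) (q l)" if "k < 4" "l < 4" "l \<noteq> k" "l \<noteq> Suc k mod 4" "k \<noteq> Suc l mod 4" for k l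
  proof -
    have "Fs ! k \<inter> Fs ! l = {}" using opp that by blast
    then show ?thesis using Fc_meet[OF q(1) q(1) dq] q(2) that by auto
  qed
  have "adj T (q 0) (q 2) \<longleftrightarrow> \<not> adj T (q 1) (q 3)"
  proof (rule pog_square[OF pog])
    have m: "Suc 0 mod 4 = 1" "Suc 1 mod 4 = 2" "Suc 2 mod 4 = 3" "Suc 3 mod 4 = 0" by simp_all
    show "adj T (q 0) (q 1)" "adj T (q 1) (q 2)" "adj T (q 2) (q 3)" "adj T (q 3) (q 0)"
      using ad[of 0, unfolded m] ad[of 1, unfolded m] ad[of 2, unfolded m] ad[of 3, unfolded m]
      by (simp_all only: zero_less_numeral one_less_numeral_iff numeral_less_iff semiring_norm simp_thms)
    show "q 0 \<noteq> q 2" "q 1 \<noteq> q 3" using dq by simp_all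
  qed
  then show False using nad[of 0 2] nad[of 1 3] by simp
qed

end

lemma realizable_imp_polytope:
  assumes "pogorelov_complex T" "realizable T"
  obtains P where "pogorelov_polytope P" "\<And>k. card (k_gonal_facets k P) = card {i \<in> \<Union>T. deg T i = k}"
proof -
  obtain a :: "nat \<Rightarrow> real^3" and b where "\<forall>t\<in>T. \<exists>x. \<forall>i\<in>\<Union>T. a i \<bullet> x \<le> b i \<and> (a i \<bullet> x = b i \<longleftrightarrow> i \<in> t)"
    using assms(2) unfolding realizable_def by (elim exE)
  from bchoice[OF this] obtain p where p: "\<forall>t\<in>T. \<forall>i\<in>\<Union>T. a i \<bullet> p t \<le> b i \<and> (a i \<bullet> p t = b i \<longleftrightarrow> i \<in> t)"
    by (elim exE)
  interpret realization T a b p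
  proof
    show "finite T" "T \<noteq> {}" by (rule pog_finite pog_nonempty assms(1))+
    show "card t = 3" if "t \<in> T" for t using pog_card[OF assms(1) that] .
    show "\<exists>t'\<in>T. t \<inter> t' = t - {i}" if "t \<in> T" "i \<in> t" for t i using pog_edge[OF assms(1) that] .
    show "a i \<bullet> p t \<le> b i" "(a i \<bullet> p t = b i) = (i \<in> t)" if "t \<in> T" "i \<in> \<Union>T" for t i
      using p that by blast+
  qed
  show thesis
  proof (rule that)
    show "pogorelov_polytope P"
      unfolding pogorelov_polytope_def using simple flag_P[OF assms(1)] no_4_belt[OF assms(1)] by blast
  qed (rule card_k_gonal)
qed

subsection \<open>Cutting off consecutive edges of a facet\<close>

text \<open>\<open>G 0, \<dots>, G (m - 1)\<close> are the neighbours of the facet \<open>F\<close> in cyclic order.\<close>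

definition link_cycle :: "nat set set \<Rightarrow> nat \<Rightarrow> nat \<Rightarrow> (nat \<Rightarrow> nat) \<Rightarrow> bool" where
  "link_cycle T F m G \<longleftrightarrow> inj_on G {..<m} \<and> F \<notin> G ` {..<m} \<and>
     {t \<in> T. F \<in> t} = (\<lambda>i. {F, G i, G (Suc i mod m)}) ` {..<m}"

text \<open>Two different positions with the same vertex would each be the cyclic successor of the
  other, which is impossible for \<open>m \<ge> 3\<close>.\<close>

lemma link_cycle_inj:
  assumes "link_cycle T F m G" "3 \<le> m"
  shows "inj_on (\<lambda>i. {F, G i, G (Suc i mod m)}) {..<m}"
proof (rule inj_onI)
  have G: "G i = G j \<longleftrightarrow> i = j" "G i \<noteq> F" if "i < m" "j < m" for i j
    using assms(1) that unfolding link_cycle_def inj_on_def by blast+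
  fix i j assume h: "i \<in> {..<m}" "j \<in> {..<m}"
    "{F, G i, G (Suc i mod m)} = {F, G j, G (Suc j mod m)}"
  have lt: "i < m" "j < m" "Suc i mod m < m" "Suc j mod m < m" using h(1,2) assms(2) by auto
  have "G i \<in> {F, G j, G (Suc j mod m)}" "G j \<in> {F, G i, G (Suc i mod m)}"
    using h(3) by blast+
  then have "i = j \<or> i = Suc j mod m" "j = i \<or> j = Suc i mod m"
    using G lt by auto
  then show "i = j" using assms(2) lt(1,2) by (auto simp: mod_Suc split: if_splits)
qed

lemma deg_link_cycle: "link_cycle T F m G \<Longrightarrow> 3 \<le> m \<Longrightarrow> deg T F = m"
  using card_image[OF link_cycle_inj[of T F m G]] by (simp add: deg_def link_cycle_def)

text \<open>A plane cuts off the consecutive vertices \<open>v 0, \<dots>, v s\<close> of the \<open>m\<close>-gon \<open>F\<close>, that is, the edges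
  which \<open>F\<close> shares with \<open>G 1, \<dots>, G s\<close>. The new facet \<open>N\<close> takes the place of \<open>F\<close> at these vertices.\<close>

locale cut =
  fixes T :: "nat set set" and F m :: nat and G :: "nat \<Rightarrow> nat" and s N :: nat
  assumes pog: "pogorelov_complex T" and link: "link_cycle T F m G"
    and s2: "2 \<le> s" and sm: "s + 4 \<le> m" and N: "N \<notin> \<Union>T"
begin

definition v :: "nat \<Rightarrow> nat set" where
  "v i = {F, G i, G (Suc i mod m)}"

definition cut_off :: "nat set \<Rightarrow> nat set" where
  "cut_off t = (if t \<in> v ` {..s} then insert N (t - {F}) else t)"

text \<open>The relabelled vertices are the points where the plane crosses the edges leaving
  \<open>F\<close> at the cut vertices. The two additional ones are the ends of the new edge between
  \<open>N\<close> and \<open>F\<close>; they lie on the edges of \<open>F\<close> with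
  \<open>G 0\<close> and \<open>G (Suc s)\<close>.\<close>

definition T' :: "nat set set" where
  "T' = cut_off ` T \<union> {{N, F, G 0}, {N, F, G (Suc s)}}"

lemma G_eq: "i < m \<Longrightarrow> j < m \<Longrightarrow> G i = G j \<longleftrightarrow> i = j"
  using link unfolding link_cycle_def inj_on_def by blast

lemma G_F: "i < m \<Longrightarrow> G i \<noteq> F" "i < m \<Longrightarrow> F \<noteq> G i"
  using link unfolding link_cycle_def by blast+

lemma star_F: "{t \<in> T. F \<in> t} = v ` {..<m}"
  using link unfolding link_cycle_def v_def[abs_def] by blast

lemma v_T: "i < m \<Longrightarrow> v i \<in> T"
  using star_F by blast

lemma F_v: "F \<in> v i" by (simp add: v_def)

lemma T_F: "t \<in> T \<Longrightarrow> F \<in> t \<Longrightarrow> \<exists>i<m. t = v i"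
  using star_F by blast

lemma v_Suc: "Suc i < m \<Longrightarrow> v i = {F, G i, G (Suc i)}"
  by (simp add: v_def)

lemma v_last: "v (m - 1) = {F, G (m - 1), G 0}"
  using sm by (simp add: v_def)

lemma G_in_v: "i < m \<Longrightarrow> k < m \<Longrightarrow> G i \<in> v k \<longleftrightarrow> i = k \<or> i = Suc k mod m"
  using G_eq[of i k] G_eq[of i "Suc k mod m"] G_F[of i] by (auto simp: v_def)

lemma v_eq: "i < m \<Longrightarrow> j < m \<Longrightarrow> v i = v j \<longleftrightarrow> i = j"
  using link_cycle_inj[OF link] sm unfolding v_def[abs_def, symmetric] inj_on_def by auto

lemma N_T: "t \<in> T \<Longrightarrow> N \<notin> t" using N by blast

lemma N_F: "N \<noteq> F" "F \<noteq> N"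
  using N v_T[of 0] F_v[of 0] sm by auto

lemma N_G: "i < m \<Longrightarrow> N \<noteq> G i" "i < m \<Longrightarrow> G i \<noteq> N"
  using N_T[OF v_T[of i]] by (auto simp: v_def)

lemma cut_off_v: "i \<le> s \<Longrightarrow> cut_off (v i) = {N, G i, G (Suc i)}"
  using sm G_F[of i] G_F[of "Suc i"] by (auto simp: cut_off_def v_Suc)

lemma cut_off_other: "t \<notin> v ` {..s} \<Longrightarrow> cut_off t = t"
  by (simp add: cut_off_def)

lemma mem_T': "t' \<in> T' \<longleftrightarrow> (t' \<in> T \<and> t' \<notin> v ` {..s}) \<or> (\<exists>i\<le>s. t' = {N, G i, G (Suc i)}) \<or>
    t' = {N, F, G 0} \<or> t' = {N, F, G (Suc s)}"
proof -
  have "t' \<in> cut_off ` T \<longleftrightarrow> (t' \<in> T \<and> t' \<notin> v ` {..s}) \<or> (\<exists>i\<le>s. t' = {N, G i, G (Suc i)})" (is "?L = ?R")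
  proof
    assume ?L
    then obtain t where t: "t \<in> T" "t' = cut_off t" by blast
    show ?R
    proof (cases "t \<in> v ` {..s}")
      case True
      then obtain i where "i \<le> s" "t = v i" by blast
      then have "t' = {N, G i, G (Suc i)}" using t(2) cut_off_v by simp
      then show ?R using \<open>i \<le> s\<close> by blast
    next
      case False
      then show ?R using t cut_off_other by simp
    qed
  next
    assume ?R
    then show ?L
    proof
      assume "t' \<in> T \<and> t' \<notin> v ` {..s}"
      then show ?L using cut_off_other by (metis imageI)
    next
      assume "\<exists>i\<le>s. t' = {N, G i, G (Suc i)}"
      then obtain i where i: "i \<le> s" "t' = cut_off (v i)" using cut_off_v by metis
      then have "v i \<in> T" using v_T sm by simp
      then show ?L using i by blast
    qed
  qed
  then show ?thesis by (auto simp: T'_def)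
qed

lemma T'_old: "t \<in> T \<Longrightarrow> t \<notin> v ` {..s} \<Longrightarrow> t \<in> T'"
  and T'_new: "i \<le> s \<Longrightarrow> {N, G i, G (Suc i)} \<in> T'"
  and T'_0: "{N, F, G 0} \<in> T'" and T'_s: "{N, F, G (Suc s)} \<in> T'"
  by (auto simp: mem_T')

section \<open>Adjacency, triangles and 4-cycles after a cut\<close>

lemma adj_F: "adj T F x \<longleftrightarrow> x \<in> G ` {..<m}"
proof
  assume "adj T F x"
  then obtain t where t: "t \<in> T" "F \<in> t" "x \<in> t" "x \<noteq> F" by (auto simp: adj_def)
  obtain i where "i < m" "t = v i" using T_F[OF t(1,2)] by blast
  moreover from this have "Suc i mod m < m" by simp
  ultimately show "x \<in> G ` {..<m}" using t(3,4) by (auto simp: v_def)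
next
  assume "x \<in> G ` {..<m}"
  then obtain i where "i < m" "x = G i" by blast
  then show "adj T F x" using v_T[of i] G_F by (auto simp: adj_def v_def)
qed

text \<open>Two adjacent neighbours of \<open>F\<close> form a triangle with it, so
  \<open>pog_triangle\<close> puts them on a common vertex of \<open>F\<close>, where they are
  consecutive.\<close>

lemma adj_G:
  assumes "i < m" "j < m" "adj T (G i) (G j)"
  shows "j = Suc i mod m \<or> i = Suc j mod m"
proof -
  have ne: "i \<noteq> j" using assms(3) by auto
  have "{F, G i, G j} \<in> T"
    using assms by (intro pog_triangle[OF pog]) (auto simp: adj_F)
  then obtain k where k: "k < m" "{F, G i, G j} = v k" using T_F by blast
  then have "G i \<in> v k" "G j \<in> v k" by blast+
  then show ?thesis using G_in_v assms k(1) ne by blast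
qed

abbreviation "A \<equiv> G ` {1..s}"

text \<open>A relabelled vertex still joins \<open>G i\<close> and \<open>G (Suc i)\<close>, and the
  two new vertices keep \<open>F\<close> adjacent to both ends of the arc. Among the old facets,
  only the cut edges of \<open>F\<close> are therefore lost.\<close>

lemma adj'_iff:
  assumes "x \<noteq> N" "y \<noteq> N"
  shows "adj T' x y \<longleftrightarrow> adj T x y \<and> \<not> (x = F \<and> y \<in> A) \<and> \<not> (y = F \<and> x \<in> A)"
proof -
  have A0: "G 0 \<notin> A" "G (Suc s) \<notin> A" using G_eq sm by auto
  \<comment> \<open>\<open>G i\<close> meets \<open>F\<close> only at \<open>v (i - 1)\<close> and
    \<open>v i\<close>, which are both cut off if \<open>1 \<le> i \<le> s\<close>.\<close>
  have notA: "y \<notin> A" if t: "t \<in> T" "t \<notin> v ` {..s}" "F \<in> t" "y \<in> t" for t y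
  proof
    assume "y \<in> A"
    then obtain i where i: "y = G i" "1 \<le> i" "i \<le> s" by auto
    obtain k where k: "k < m" "t = v k" using T_F t by blast
    then have "\<not> k \<le> s" using t(2) by auto
    moreover have "i = k \<or> i = Suc k mod m" using G_in_v[of i k] i k t(4) sm by auto
    ultimately show False using i k(1) by (auto simp: mod_Suc split: if_splits)
  qed
  show ?thesis
  proof
    assume "adj T' x y"
    then obtain t' where t': "t' \<in> T'" "x \<in> t'" "y \<in> t'" "x \<noteq> y" by (auto simp: adj_def)
    from t'(1) consider "t' \<in> T" "t' \<notin> v ` {..s}" | i where "i \<le> s" "t' = {N, G i, G (Suc i)}"
      | "t' = {N, F, G 0}" | "t' = {N, F, G (Suc s)}" unfolding mem_T' by blast
    then show "adj T x y \<and> \<not> (x = F \<and> y \<in> A) \<and> \<not> (y = F \<and> x \<in> A)"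
    proof cases
      case 1
      then show ?thesis using t' notA unfolding adj_def by blast
    next
      case 2
      then have "x \<in> v i" "y \<in> v i" "x \<noteq> F" "y \<noteq> F"
        using t' assms sm G_F[of i] G_F[of "Suc i"] by (auto simp: v_def)
      then show ?thesis using t'(4) v_T[of i] 2(1) sm by (auto simp: adj_def)
    next
      case 3
      then show ?thesis using t' assms A0 adj_F[of "G 0"] adj_sym[of T "G 0" F] sm G_F[of 0] by auto
    next
      case 4
      then show ?thesis using t' assms A0 adj_F[of "G (Suc s)"] adj_sym[of T "G (Suc s)" F] sm G_F[of "Suc s"] by auto
    qed
  next
    have key: "adj T' F y" if h: "adj T F y" "y \<notin> A" for y
    proof -
      obtain t where t: "t \<in> T" "F \<in> t" "y \<in> t" "y \<noteq> F" using h(1) by (auto simp: adj_def)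
      show ?thesis
      proof (cases "t \<in> v ` {..s}")
        case True
        then obtain k where k: "k \<le> s" "t = v k" by blast
        then have "y = G k \<or> y = G (Suc k)" using t sm by (auto simp: v_Suc)
        then have "y = G 0 \<or> y = G (Suc s)" using h(2) k(1)
          by (metis One_nat_def Suc_leI atLeastAtMost_iff bot_nat_0.not_eq_extremum image_eqI le_SucI le_antisym not_less_eq_eq)
        then show ?thesis using adjI[OF T'_0, of F y] adjI[OF T'_s, of F y] t(4) by blast
      next
        case False
        then show ?thesis using adjI[OF T'_old[OF t(1)]] t by blast
      qed
    qed
    assume h: "adj T x y \<and> \<not> (x = F \<and> y \<in> A) \<and> \<not> (y = F \<and> x \<in> A)"
    show "adj T' x y"
    proof (cases "x = F \<or> y = F")
      case True
      then show ?thesis using key h adj_sym by blast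
    next
      case False
      obtain t where t: "t \<in> T" "x \<in> t" "y \<in> t" "x \<noteq> y" using h by (auto simp: adj_def)
      show ?thesis
      proof (cases "t \<in> v ` {..s}")
        case True
        then obtain k where k: "k \<le> s" "t = v k" by blast
        then have "x \<in> {N, G k, G (Suc k)}" "y \<in> {N, G k, G (Suc k)}"
          using t False sm by (auto simp: v_Suc)
        then show ?thesis using adjI[OF T'_new[OF k(1)]] t(4) by blast
      next
        case False
        then show ?thesis using adjI[OF T'_old[OF t(1)]] t by blast
      qed
    qed
  qed
qed

lemma adj'_N: "adj T' N x \<longleftrightarrow> x = F \<or> x \<in> G ` {..Suc s}"
proof
  assume "adj T' N x"
  then obtain t' where t': "t' \<in> T'" "N \<in> t'" "x \<in> t'" "x \<noteq> N" by (auto simp: adj_def)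
  then show "x = F \<or> x \<in> G ` {..Suc s}"
    using N_T unfolding mem_T' by auto
next
  assume "x = F \<or> x \<in> G ` {..Suc s}"
  then consider "x = F" | i where "x = G i" "i \<le> s" | "x = G (Suc s)"
    by (auto simp: le_Suc_eq)
  then show "adj T' N x"
  proof cases
    case 1
    then show ?thesis using adjI[OF T'_0, of N F] N_F by blast
  next
    case (2 i)
    then show ?thesis using adjI[OF T'_new[of i], of N "G i"] N_G[of i] sm by auto
  next
    case 3
    then show ?thesis using adjI[OF T'_s, of N "G (Suc s)"] N_G[of "Suc s"] sm by auto
  qed
qed

lemma adj'_N_sym: "adj T' x N \<longleftrightarrow> x = F \<or> x \<in> G ` {..Suc s}"
  using adj'_N adj_sym by metis

text \<open>A wrap-around pair would involve the index \<open>m - 1\<close>, which exceeds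
  \<open>Suc s\<close>. The \<open>G i\<close> around \<open>N\<close> thus form a path without
  chords, which \<open>F\<close> closes to a cycle of length \<open>s + 3\<close>.\<close>

lemma adj'_GG:
  assumes "i \<le> Suc s" "j \<le> Suc s" "adj T' (G i) (G j)"
  shows "j = Suc i \<or> i = Suc j"
proof -
  have "adj T (G i) (G j)" using assms adj'_iff[of "G i" "G j"] N_G[of i] N_G[of j] sm by simp
  then show ?thesis using adj_G[of i j] assms(1,2) sm by (auto simp: mod_Suc split: if_splits)
qed

lemma adj'_FG:
  assumes "i \<le> Suc s" "adj T' F (G i)" shows "i = 0 \<or> i = Suc s"
  using assms adj'_iff[of F "G i"] N_G[of i] N_F sm by (cases "i = 0 \<or> i = Suc s") auto

lemma triangle_N:
  assumes "adj T' N y" "adj T' y z" "adj T' N z" shows "{N, y, z} \<in> T'"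
proof -
  have main: "{N, y, z} \<in> T'" if h: "y = F" "adj T' y z" "adj T' N z" for y z
  proof -
    have "z \<noteq> F" using h by auto
    then obtain i where i: "i \<le> Suc s" "z = G i" using h(3) adj'_N by auto
    then show ?thesis using adj'_FG h T'_0 T'_s by auto
  qed
  consider "y = F" | "z = F" | i j where "y = G i" "z = G j" "i \<le> Suc s" "j \<le> Suc s"
    using assms(1,3) unfolding adj'_N by auto
  then show ?thesis
  proof cases
    case 1 then show ?thesis using main assms by blast
  next
    case 2
    then have "{N, z, y} \<in> T'" using main assms adj_sym by blast
    then show ?thesis by (simp add: insert_commute)
  next
    case (3 i j)
    then have "j = Suc i \<or> i = Suc j" using adj'_GG assms(2) by blast
    then show ?thesis using T'_new[of i] T'_new[of j] 3 by (auto simp: insert_commute)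
  qed
qed

lemma triangle':
  assumes "adj T' x y" "adj T' y z" "adj T' x z" shows "{x, y, z} \<in> T'"
proof (cases "N \<in> {x, y, z}")
  case True
  then consider "x = N" | "y = N" | "z = N" by blast
  then show ?thesis
  proof cases
    case 1 then show ?thesis using triangle_N assms by blast
  next
    case 2
    then have "{N, x, z} \<in> T'" using triangle_N[of x z] assms adj_sym by blast
    then show ?thesis using 2 by (simp add: insert_commute)
  next
    case 3
    then have "{N, x, y} \<in> T'" using triangle_N[of x y] assms adj_sym by blast
    then show ?thesis using 3 by (simp add: insert_commute)
  qed
next
  case False
  then have xyz: "x \<noteq> N" "y \<noteq> N" "z \<noteq> N" by auto
  have "{x, y, z} \<in> T"
    by (rule pog_triangle[OF pog]) (use assms xyz adj'_iff in blast)+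
  moreover have "{x, y, z} \<notin> v ` {..s}"
  proof
    assume "{x, y, z} \<in> v ` {..s}"
    then obtain k where k: "k \<le> s" "{x, y, z} = {F, G k, G (Suc k)}" using sm v_Suc by force
    \<comment> \<open>Every cut vertex contains a facet that has lost its adjacency to
      \<open>F\<close>: \<open>G 1\<close> at \<open>k = 0\<close>, and \<open>G k\<close>
      otherwise.\<close>
    have kA: "G k \<in> A \<or> G (Suc k) \<in> A" using k(1) s2 by (cases "k = 0") auto
    have "adj T' F (G k)" "adj T' F (G (Suc k))"
      using k(2) assms adj_sym G_F[of k] G_F[of "Suc k"] k(1) sm by (auto simp: set_eq_iff adj_sym; metis)+
    then show False
      using kA adj'_iff N_F N_G[of k] N_G[of "Suc k"] k(1) sm by auto
  qed
  ultimately show ?thesis by (rule T'_old)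
qed

lemma square_N:
  assumes "adj T' N b" "adj T' b c" "adj T' c d" "adj T' d N" "N \<noteq> c" "b \<noteq> d"
  shows "adj T' N c \<longleftrightarrow> \<not> adj T' b d"
proof
  have b: "b = F \<or> b \<in> G ` {..Suc s}" and d: "d = F \<or> d \<in> G ` {..Suc s}"
    using assms(1,4) adj'_N adj'_N_sym by blast+
  assume c: "adj T' N c"
  show "\<not> adj T' b d"
  proof
    assume bd: "adj T' b d"
    \<comment> \<open>Within the arc \<open>F\<close> is adjacent only to the two ends, and these
      are not adjacent to each other. Without \<open>F\<close>, three indices would have to differ
      pairwise by 1.\<close>
    have noF: False if h: "adj T' F x" "adj T' F y" "adj T' x y" "adj T' N x" "adj T' N y" for x y
    proof -
      have "x \<noteq> F" "y \<noteq> F" using h by auto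
      then obtain i j where "x = G i" "y = G j" "i \<le> Suc s" "j \<le> Suc s"
        using h(4,5) unfolding adj'_N by auto
      then show False using h adj'_FG[of i] adj'_FG[of j] adj'_GG[of i j] s2 by auto
    qed
    have ad: "adj T' N d" using assms(4) adj_sym by blast
    show False
    proof (cases "b = F \<or> c = F \<or> d = F")
      case True
      then show False using noF[of c d] noF[of b d] noF[of b c] assms c bd ad adj_sym by blast
    next
      case False
      then obtain i j k where "b = G i" "c = G j" "d = G k" "i \<le> Suc s" "j \<le> Suc s" "k \<le> Suc s"
        using b d c unfolding adj'_N by auto
      then show False
        using adj'_GG[of i j] adj'_GG[of j k] adj'_GG[of i k] assms(2,3) bd by auto
    qed
  qed
next
  have b: "b = F \<or> b \<in> G ` {..Suc s}" and d: "d = F \<or> d \<in> G ` {..Suc s}"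
    using assms(1,4) adj'_N adj'_N_sym by blast+
  assume nbd: "\<not> adj T' b d"
  show "adj T' N c"
  proof (rule ccontr)
    assume c: "\<not> adj T' N c"
    then have cF: "c \<noteq> F" and cG: "\<And>i. i \<le> Suc s \<Longrightarrow> c \<noteq> G i" unfolding adj'_N by auto
    have ne: "b \<noteq> N" "d \<noteq> N" "c \<noteq> N" using assms by auto
    have bc: "adj T b c" "adj T c d" using assms(2,3) adj'_iff ne by blast+
    \<comment> \<open>Suppose \<open>F\<close> is one of the two common neighbours. The other is
      some \<open>G q\<close> with \<open>1 \<le> q \<le> s\<close>, and \<open>c\<close> is a
      neighbour of \<open>F\<close> next to it in the cycle, hence still within the arc around
      \<open>N\<close>.\<close>
    have noF: False if h: "adj T' F c" "adj T c y" "y \<in> G ` {..Suc s}" "\<not> adj T' F y" for y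
    proof -
      obtain q where q: "y = G q" "q \<le> Suc s" using h(3) by blast
      have "q \<noteq> 0 \<and> q \<noteq> Suc s"
        using h(4) q adjI[OF T'_0, of F "G 0"] adjI[OF T'_s, of F "G (Suc s)"] G_F(2)[of 0] G_F(2)[of "Suc s"] sm
        by (intro conjI notI) auto
      then have q': "1 \<le> q" "q \<le> s" using q(2) by auto
      have "adj T F c" using h(1) adj'_iff ne N_F by blast
      then obtain r where r: "r < m" "c = G r" using adj_F by blast
      then have "q = Suc r mod m \<or> r = Suc q mod m" using adj_G[of r q] h(2) q r sm by auto
      then have "r \<le> Suc s" using q' r(1) sm by (auto simp: mod_Suc split: if_splits)
      then show False using cG r by blast
    qed
    show False
    proof (cases "b = F \<or> d = F")
      case True
      then show False using noF[of d] noF[of b] assms bc nbd b d adj_sym by metis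
    next
      case False
      then obtain p q where pq: "b = G p" "d = G q" "p \<le> Suc s" "q \<le> Suc s" using b d by auto
      have nb: "\<not> adj T b d" using nbd adj'_iff ne False by blast
      have "adj T F b" "adj T d F" using pq sm adj_F adj_sym[of T d F] by auto
      then have "adj T F c \<longleftrightarrow> \<not> adj T b d"
        using pog_square[OF pog, of F b c d] bc cF assms(6) by blast
      then obtain r where r: "r < m" "c = G r" using nb adj_F by blast
      \<comment> \<open>\<open>c\<close> lies outside the arc but next to two different facets of
        it, so it would be both \<open>G (s + 2)\<close> and \<open>G (m - 1)\<close>. This is where
        \<open>m \<ge> s + 4\<close> is needed.\<close>
      have rs: "r > Suc s" using cG[of r] r by (cases "r \<le> Suc s") auto
      have "r = Suc p mod m \<or> p = Suc r mod m" "q = Suc r mod m \<or> r = Suc q mod m"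
        using adj_G[of p r] adj_G[of r q] bc pq r sm by auto
      moreover have "p \<noteq> q" using assms(6) pq by blast
      ultimately show False using rs r(1) pq(3,4) sm
        by (auto simp: mod_Suc split: if_splits)
    qed
  qed
qed

lemma square':
  assumes "adj T' a b" "adj T' b c" "adj T' c d" "adj T' d a" "a \<noteq> c" "b \<noteq> d"
  shows "adj T' a c \<longleftrightarrow> \<not> adj T' b d"
proof (cases "N \<in> {a, b, c, d}")
  case True
  then consider "a = N" | "b = N" | "c = N" | "d = N" by blast
  then show ?thesis
  proof cases
    case 1 then show ?thesis using square_N assms by blast
  next
    case 2 then show ?thesis using square_N[of c d a] assms adj_sym by metis
  next
    case 3 then show ?thesis using square_N[of d a b] assms adj_sym by metis
  next
    case 4 then show ?thesis using square_N[of a b c] assms adj_sym by metis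
  qed
next
  case False
  then have ne: "a \<noteq> N" "b \<noteq> N" "c \<noteq> N" "d \<noteq> N" by auto
  have ad: "adj T a b" "adj T b c" "adj T c d" "adj T d a"
    using assms adj'_iff ne by blast+
  have iff: "adj T a c \<longleftrightarrow> \<not> adj T b d"
    using pog_square[OF pog ad] assms by blast
  \<comment> \<open>A lost diagonal joins \<open>F\<close> to some \<open>G i\<close> with
    \<open>1 \<le> i \<le> s\<close>. The other two corners would be \<open>G (i - 1)\<close> and
    \<open>G (i + 1)\<close>, both still adjacent to \<open>F\<close>; then \<open>i = 1\<close> and
    \<open>i = s\<close>, against \<open>s \<ge> 2\<close>.\<close>
  have key: "x \<noteq> F" if h: "adj T' x y" "adj T' y z" "adj T' z w" "adj T' w x" "y \<noteq> w" "z \<in> A"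
    "y \<noteq> N" "w \<noteq> N" for x y z w
  proof
    assume x: "x = F"
    obtain i where i: "z = G i" "1 \<le> i" "i \<le> s" using h(6) by auto
    have nb: "\<exists>r<m. r \<notin> {1..s} \<and> u = G r \<and> (r = Suc i \<or> i = Suc r)" if u: "adj T' F u" "adj T' u z" "u \<noteq> N" for u
    proof -
      have "adj T F u" "u \<notin> A" using u adj'_iff N_F by blast+
      then obtain r where r: "r < m" "u = G r" using adj_F by blast
      have "adj T u z" using u adj'_iff N_G[of i] i sm by auto
      then have "i = Suc r mod m \<or> r = Suc i mod m" using adj_G[of r i] r i sm by auto
      then have "r = Suc i \<or> i = Suc r" using i r sm by (auto simp: mod_Suc split: if_splits)
      then show ?thesis using r \<open>u \<notin> A\<close> by blast
    qed
    obtain r where r: "r < m" "r \<notin> {1..s}" "y = G r" "r = Suc i \<or> i = Suc r"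
      using nb[of y] h x by blast
    obtain r' where r': "r' < m" "r' \<notin> {1..s}" "w = G r'" "r' = Suc i \<or> i = Suc r'"
      using nb[of w] h x adj_sym by blast
    have "r \<noteq> r'" using h(5) r(3) r'(3) by blast
    then show False using r(2,4) r'(2,4) i s2 by auto
  qed
  have 1: "adj T' a c \<longleftrightarrow> adj T a c"
    using adj'_iff[OF ne(1,3)] key[of a b c d] key[of c d a b] assms ne adj_sym by blast
  have 2: "adj T' b d \<longleftrightarrow> adj T b d"
    using adj'_iff[OF ne(2,4)] key[of b c d a] key[of d a b c] assms ne adj_sym by blast
  show ?thesis using 1 2 iff by blast
qed

lemma v_kept:
  assumes "s < k" "k < m" shows "v k \<notin> v ` {..s}"
proof
  assume "v k \<in> v ` {..s}"
  then obtain i where "i \<le> s" "v k = v i" by blast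
  then show False using v_eq[of k i] assms by simp
qed

lemma edge':
  assumes "t \<in> T'" "i \<in> t" shows "\<exists>t'\<in>T'. t \<inter> t' = t - {i}"
proof -
  have ne: "G j \<noteq> F" "F \<noteq> G j" "G j \<noteq> N" "N \<noteq> G j" if "j \<le> Suc s" for j
    using G_F[of j] N_G[of j] that sm by auto
  have Gne: "G j = G k \<longleftrightarrow> j = k" if "j \<le> Suc s" "k \<le> Suc s" for j k
    using G_eq that sm by simp
  have G0s: "G 0 \<noteq> G (Suc s)" using Gne by simp
  from assms(1) consider "t \<in> T" "t \<notin> v ` {..s}" | q where "q \<le> s" "t = {N, G q, G (Suc q)}"
      | "t = {N, F, G 0}" | "t = {N, F, G (Suc s)}" unfolding mem_T' by blast
  then show ?thesis
  proof cases
    case 1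
    obtain t' where t': "t' \<in> T" "t \<inter> t' = t - {i}" using pog_edge[OF pog 1(1) assms(2)] by blast
    show ?thesis
    proof (cases "t' \<in> v ` {..s}")
      case False then show ?thesis using t' T'_old by blast
    next
      case True
      then obtain q where q: "q \<le> s" "t' = {F, G q, G (Suc q)}" using v_Suc sm by auto
      have Nt: "N \<notin> t" using N_T 1 by blast
      have ct: "card (t - {i}) = 2" unfolding card_Diff_singleton[OF assms(2)] pog_card[OF pog 1(1)] by simp
      \<comment> \<open>The old neighbour has been cut off. An edge not on \<open>F\<close> now ends
        at the relabelled neighbour; an edge on \<open>F\<close> is crossed by the plane and ends at
        \<open>{N, F, y}\<close>, where \<open>y\<close> is \<open>G 0\<close> or
        \<open>G (Suc s)\<close>.\<close>
      show ?thesis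
      proof (cases "F \<in> t - {i}")
        case False
        have "t - {i} \<subseteq> t'" unfolding t'(2)[symmetric] by blast
        then have sub: "t - {i} \<subseteq> {G q, G (Suc q)}" using False unfolding q(2) by auto
        have "card {G q, G (Suc q)} = 2" using Gne[of q "Suc q"] q(1) by simp
        then have "t - {i} = {G q, G (Suc q)}"
          using sub ct by (intro card_subset_eq) auto
        moreover have "i \<notin> t \<inter> t'" unfolding t'(2) by blast
        then have "i \<notin> {N, G q, G (Suc q)}" using assms(2) Nt q(2) by auto
        ultimately have "t \<inter> {N, G q, G (Suc q)} = t - {i}" using Nt by auto
        then show ?thesis using T'_new[OF q(1)] by blast
      next
        case True
        then obtain k where k: "k < m" "t = v k" using T_F 1 by blast
        then have ks: "\<not> k \<le> s" using 1(2) by auto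
        have "card (t - {i}) \<noteq> card {F}" using ct by simp
        then have "t - {i} \<noteq> {F}" by metis
        then obtain y where y: "y \<in> t" "y \<noteq> i" "y \<noteq> F" using True by blast
        then have "y \<in> t \<inter> t'" unfolding t'(2) by blast
        then have y': "y = G q \<or> y = G (Suc q)" using y(3) unfolding q(2) by blast
        have "q \<le> Suc s" "Suc q \<le> Suc s" using q(1) by simp_all
        then obtain r where r: "y = G r" "r \<le> Suc s" using y' by metis
        then have "r = k \<or> r = Suc k mod m" using G_in_v[of r k] y(1) k sm by simp
        then have "r = 0 \<or> r = Suc s" using r(2) ks k(1) by (auto simp: mod_Suc split: if_splits)
        then have "y = G 0 \<or> y = G (Suc s)" using r(1) by blast
        moreover have "t - {i} = {F, y}"
        proof (rule card_subset_eq[symmetric])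
          show "finite (t - {i})" using ct by (intro card_ge_0_finite) simp
          show "{F, y} \<subseteq> t - {i}" using y True by blast
          show "card {F, y} = card (t - {i})" using ct y by simp
        qed
        moreover have "i \<notin> {N, F, y}" using Nt assms(2) True y by blast
        ultimately have "t \<inter> {N, F, y} = t - {i}" using Nt by blast
        then show ?thesis using \<open>y = G 0 \<or> y = G (Suc s)\<close> T'_0 T'_s by metis
      qed
    qed
  next
    case (2 q)
    have vq: "v q \<in> T" "v q = {F, G q, G (Suc q)}" using v_T[of q] v_Suc[of q] 2 sm by auto
    from 2 assms(2) consider "i = N" | "i = G q" | "i = G (Suc q)" by blast
    then show ?thesis
    proof cases
      case 1
      obtain t' where t': "t' \<in> T" "v q \<inter> t' = v q - {F}" using pog_edge[OF pog vq(1)] vq(2) by blast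
      have "F \<notin> t'" using t'(2) vq(2) by blast
      then have "t' \<in> T'" using T'_old t' F_v by blast
      moreover have "t \<inter> t' = t - {i}"
        using t' vq(2) 2 1 N_T ne[of q] ne[of "Suc q"] by auto
      ultimately show ?thesis by blast
    next
      case 2: 2
      show ?thesis
      proof (cases "q = s")
        case True
        have "t \<inter> {N, F, G (Suc s)} = t - {i}" using 2 \<open>t = _\<close> True ne[of s] ne[of "Suc s"] Gne by auto
        then show ?thesis using T'_s by blast
      next
        case False
        then have qs: "Suc q \<le> s" using \<open>q \<le> s\<close> by simp
        have "t \<inter> {N, G (Suc q), G (Suc (Suc q))} = t - {i}"
          using 2 \<open>t = _\<close> qs ne[of q] ne[of "Suc q"] ne[of "Suc (Suc q)"] Gne[of q "Suc q"] Gne[of q "Suc (Suc q)"] by auto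
        then show ?thesis using T'_new[OF qs] by blast
      qed
    next
      case 3: 3
      show ?thesis
      proof (cases "q = 0")
        case True
        have "t \<inter> {N, F, G 0} = t - {i}" using 3 \<open>t = _\<close> True ne[of 0] ne[of 1] Gne[of 0 1] by auto
        then show ?thesis using T'_0 by blast
      next
        case False
        then obtain r where r: "q = Suc r" by (cases q) auto
        have "t \<inter> {N, G r, G (Suc r)} = t - {i}"
          using 3 \<open>t = _\<close> r \<open>q \<le> s\<close> ne[of q] ne[of "Suc q"] ne[of r] Gne[of q "Suc q"] Gne[of r "Suc q"] by auto
        then show ?thesis using T'_new[of r] r \<open>q \<le> s\<close> by auto
      qed
    qed
  next
    case 3
    from 3 assms(2) consider "i = N" | "i = F" | "i = G 0" by blast
    then show ?thesis
    proof cases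
      case 1
      have "v (m - 1) \<notin> v ` {..s}" using v_kept[of "m - 1"] sm by simp
      then have "v (m - 1) \<in> T'" using T'_old v_T sm by simp
      moreover have "t \<inter> v (m - 1) = t - {i}"
        using 1 3 v_last N_F N_G[of "m - 1"] N_G[of 0] sm by auto
      ultimately show ?thesis by blast
    next
      case 2
      have "t \<inter> {N, G 0, G 1} = t - {i}" using 2 3 ne[of 0] ne[of 1] N_F by auto
      then show ?thesis using T'_new[of 0] by auto
    next
      case 3: 3
      have "t \<inter> {N, F, G (Suc s)} = t - {i}" using 3 \<open>t = _\<close> ne[of 0] ne[of "Suc s"] G0s by auto
      then show ?thesis using T'_s by blast
    qed
  next
    case 4
    from 4 assms(2) consider "i = N" | "i = F" | "i = G (Suc s)" by blast
    then show ?thesis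
    proof cases
      case 1
      have "v (Suc s) \<notin> v ` {..s}" using v_kept[of "Suc s"] sm by simp
      then have "v (Suc s) \<in> T'" using T'_old v_T sm by simp
      moreover have "t \<inter> v (Suc s) = t - {i}"
        using 1 4 v_Suc[of "Suc s"] N_F N_G[of "Suc s"] N_G[of "Suc (Suc s)"] sm by auto
      ultimately show ?thesis by blast
    next
      case 2
      have "t \<inter> {N, G s, G (Suc s)} = t - {i}" using 2 4 ne[of s] ne[of "Suc s"] N_F by auto
      then show ?thesis using T'_new[of s] by auto
    next
      case 3
      have "t \<inter> {N, F, G 0} = t - {i}" using 3 4 ne[of 0] ne[of "Suc s"] G0s by auto
      then show ?thesis using T'_0 by blast
    qed
  qed
qed

lemma card':
  assumes "t \<in> T'" shows "card t = 3"
proof -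
  from assms consider "t \<in> T" | q where "q \<le> s" "t = {N, G q, G (Suc q)}"
      | "t = {N, F, G 0}" | "t = {N, F, G (Suc s)}" unfolding mem_T' by blast
  then show ?thesis
  proof cases
    case (2 q)
    then show ?thesis using N_G[of q] N_G[of "Suc q"] G_eq[of q "Suc q"] sm by simp
  qed (use pog_card[OF pog] N_F N_G[of 0] N_G[of "Suc s"] G_F[of 0] G_F[of "Suc s"] sm in auto)
qed

lemma pog': "pogorelov_complex T'"
proof -
  have "finite T'" using pog_finite[OF pog] by (simp add: T'_def)
  moreover have "T' \<noteq> {}" using T'_0 by blast
  moreover have "\<forall>t\<in>T'. card t = 3" using card' by simp
  moreover have "\<forall>t\<in>T'. \<forall>i\<in>t. \<exists>t'\<in>T'. t \<inter> t' = t - {i}" using edge' by simp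
  moreover have "\<forall>i j k. adj T' i j \<and> adj T' j k \<and> adj T' i k \<longrightarrow> {i, j, k} \<in> T'"
    by (intro allI impI, elim conjE) (rule triangle')
  moreover have "\<forall>a b c d. adj T' a b \<and> adj T' b c \<and> adj T' c d \<and> adj T' d a \<and> a \<noteq> c \<and> b \<noteq> d \<longrightarrow>
        (adj T' a c \<longleftrightarrow> \<not> adj T' b d)"
    by (intro allI impI, elim conjE) (rule square')
  ultimately show ?thesis unfolding pogorelov_complex_def by (intro conjI)
qed

lemma Union': "\<Union>T' = insert N (\<Union>T)"
proof (intro equalityI subsetI)
  fix x assume "x \<in> \<Union>T'"
  then obtain t where t: "t \<in> T'" "x \<in> t" by blast
  have G: "G i \<in> \<Union>T" if "i < m" for i using v_T[OF that] unfolding v_def by blast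
  have "F \<in> \<Union>T" using v_T[of 0] F_v[of 0] sm by auto
  then show "x \<in> insert N (\<Union>T)" using t G sm unfolding mem_T' by auto
next
  fix x assume "x \<in> insert N (\<Union>T)"
  then consider "x = N \<or> x = F" | t where "t \<in> T" "x \<in> t" "x \<noteq> F" by blast
  then show "x \<in> \<Union>T'"
  proof cases
    case 1 then show ?thesis using T'_0 by blast
  next
    case (2 t)
    then have "x \<in> cut_off t" by (simp add: cut_off_def)
    then show ?thesis using 2(1) by (auto simp: T'_def)
  qed
qed

lemma inj_cut_off: "inj_on cut_off T"
proof (rule inj_onI)
  fix t u assume h: "t \<in> T" "u \<in> T" "cut_off t = cut_off u"
  have N: "N \<notin> t" "N \<notin> u" using N_T h by blast+
  have "t \<in> v ` {..s} \<longleftrightarrow> u \<in> v ` {..s}" using N h(3) by (auto simp: cut_off_def split: if_splits)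
  then show "t = u"
  proof (cases "t \<in> v ` {..s}")
    case True
    then have "F \<in> t" "F \<in> u" "insert N (t - {F}) = insert N (u - {F})"
      using h(3) F_v \<open>_ \<longleftrightarrow> _\<close> by (auto simp: cut_off_def)
    then have "t - {F} = u - {F}" using N insert_ident[of N "t - {F}" "u - {F}"] by simp
    then show ?thesis using \<open>F \<in> t\<close> \<open>F \<in> u\<close> by (metis insert_Diff)
  qed (use h(3) in \<open>auto simp: cut_off_def split: if_splits\<close>)
qed

text \<open>\<open>cut_off\<close> is injective and alters only incidences with \<open>F\<close> and
  \<open>N\<close>. Any other facet keeps its number of vertices, except that each end of the arc
  receives one of the two new ones.\<close>

lemma deg'_old:
  assumes "x \<noteq> N" "x \<noteq> F"
  shows "deg T' x = deg T x + (if x = G 0 \<or> x = G (Suc s) then 1 else 0)"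
proof -
  have 0: "{N, F, G 0} \<notin> cut_off ` T" "{N, F, G (Suc s)} \<notin> cut_off ` T"
    using N_T N_F by (auto simp: cut_off_def)
  have mem: "x \<in> cut_off t \<longleftrightarrow> x \<in> t" for t using assms by (simp add: cut_off_def)
  have G0s: "G 0 \<noteq> G (Suc s)" using G_eq sm by simp
  have 1: "{t \<in> T'. x \<in> t} = cut_off ` {t \<in> T. x \<in> t} \<union> {t \<in> {{N, F, G 0}, {N, F, G (Suc s)}}. x \<in> t}"
    (is "_ = ?C \<union> ?D") unfolding T'_def using mem by blast
  have "?D = (if x = G 0 then {{N, F, G 0}} else if x = G (Suc s) then {{N, F, G (Suc s)}} else {})"
    using assms G0s by auto
  then have D: "card ?D = (if x = G 0 \<or> x = G (Suc s) then 1 else 0)" "finite ?D" by simp_all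
  have C: "card ?C = deg T x" "finite ?C"
    using inj_on_subset[OF inj_cut_off, of "{t \<in> T. x \<in> t}"] pog_finite[OF pog]
    by (auto simp: deg_def card_image)
  have "?D \<subseteq> {{N, F, G 0}, {N, F, G (Suc s)}}" "?C \<subseteq> cut_off ` T" by blast+
  moreover have "{{N, F, G 0}, {N, F, G (Suc s)}} \<inter> cut_off ` T = {}"
    using 0 by (simp only: Int_insert_left if_False Int_empty_left)
  ultimately have "?C \<inter> ?D = {}" by (meson disjoint_iff subsetD)
  then show ?thesis unfolding deg_def[of T'] 1 using card_Un_disjoint[OF C(2) D(2)] C(1) D(1) by simp
qed

lemma deg'_N: "deg T' N = s + 3"
proof -
  have 1: "{t \<in> T'. N \<in> t} = cut_off ` v ` {..s} \<union> {{N, F, G 0}, {N, F, G (Suc s)}}"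
  proof -
    have "cut_off t \<in> cut_off ` v ` {..s}" if "t \<in> T" "N \<in> cut_off t" for t
      using that N_T by (auto simp: cut_off_def split: if_splits)
    moreover have "v i \<in> T" if "i \<le> s" for i using that v_T sm by simp
    moreover have "N \<in> cut_off (v i)" if "i \<le> s" for i using that by (simp add: cut_off_def)
    ultimately show ?thesis unfolding T'_def by blast
  qed
  have 2: "inj_on cut_off (v ` {..s})"
    using inj_cut_off by (rule inj_on_subset) (use v_T sm in auto)
  have "inj_on v {..s}" using v_eq sm by (auto simp: inj_on_def)
  then have 3: "card (cut_off ` v ` {..s}) = s + 1" using 2 by (simp add: card_image)
  have 4: "F \<notin> t" if "t \<in> cut_off ` v ` {..s}" for t using that N_F by (auto simp: cut_off_def)
  then have 5: "{N, F, G 0} \<notin> cut_off ` v ` {..s}" "{N, F, G (Suc s)} \<notin> cut_off ` v ` {..s}" by blast+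
  have "G 0 \<noteq> G (Suc s)" "G 0 \<noteq> N" "G 0 \<noteq> F" using G_eq N_G G_F sm by simp_all
  then have 6: "{N, F, G 0} \<noteq> {N, F, G (Suc s)}" by blast
  show ?thesis unfolding deg_def 1
    using 3 5 6 by (subst card_Un_disjoint) auto
qed

text \<open>The neighbours of \<open>F\<close> after the cut. The enumeration starts at \<open>G (m - 1)\<close>, so that \<open>N\<close> lies
  in the middle of the edges removed by the next cut.\<close>

definition G' :: "nat \<Rightarrow> nat" where
  "G' j = (if j = 0 then G (m - 1) else if j = 1 then G 0 else if j = 2 then N else G (s + j - 2))"

text \<open>Of the \<open>m\<close> neighbours of \<open>F\<close>, \<open>s\<close> are lost and
  \<open>N\<close> is gained.\<close>

lemma link': "link_cycle T' F (m - s + 1) G'"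
proof -
  let ?m = "m - s + 1" and ?f = "\<lambda>i. {F, G' i, G' (Suc i mod (m - s + 1))}"
  have lt: "{..<?m} = {0, 1, 2} \<union> {3..<?m}" using sm by auto
  have G'3: "G' j = G (s + j - 2)" if "3 \<le> j" for j using that by (simp add: G'_def)
  \<comment> \<open>\<open>g j\<close> is the old position of \<open>G' j\<close>; position 2 is
    left aside, as it belongs to \<open>N\<close>.\<close>
  define g where "g j = (if j = 0 then m - 1 else if j = 1 then 0 else s + j - 2)" for j
  have g: "G' j = G (g j)" "g j < m" if "j < ?m" "j \<noteq> 2" for j
    using that sm by (auto simp: G'_def g_def)
  have inj: "inj_on G' {..<?m}"
  proof (rule inj_onI)
    have g_inj: "x = y" if "x < ?m" "y < ?m" "x \<noteq> 2" "y \<noteq> 2" "g x = g y" for x y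
      using that sm s2 by (auto simp: g_def split: if_splits)
    have G'2: "G' 2 = N" by (simp add: G'_def)
    fix i j assume h: "i \<in> {..<?m}" "j \<in> {..<?m}" "G' i = G' j"
    consider "i = 2" "j = 2" | "i = 2" "j \<noteq> 2" | "i \<noteq> 2" "j = 2" | "i \<noteq> 2" "j \<noteq> 2" by blast
    then show "i = j"
    proof cases
      case 2 then show ?thesis using h g[of j] N_G G'2 by auto
    next
      case 3 then show ?thesis using h g[of i] N_G G'2 by auto
    next
      case 4 then show ?thesis using h g[of i] g[of j] g_inj[of i j] G_eq[of "g i" "g j"] by simp
    qed simp
  qed
  have FG: "F \<notin> G' ` {..<?m}"
  proof
    assume "F \<in> G' ` {..<?m}"
    then obtain j where j: "j < ?m" "F = G' j" by auto
    then show False using g[of j] G_F[of "g j"] N_F by (cases "j = 2") (auto simp: G'_def)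
  qed
  \<comment> \<open>In the rotated enumeration \<open>v (m - 1)\<close> comes at position 0, the two
    new vertices at 1 and 2, and \<open>v (Suc s)\<close> up to \<open>v (m - 2)\<close> from
    position 3 on.\<close>
  have e0: "?f 0 = v (m - 1)" using sm v_last by (simp add: G'_def)
  have e1: "?f 1 = {N, F, G 0}" using sm by (auto simp: G'_def)
  have e2: "?f 2 = {N, F, G (Suc s)}" using sm by (auto simp: G'_def)
  have e3: "?f j = v (s + j - 2)" if "3 \<le> j" "j < ?m" for j
  proof (cases "Suc j = ?m")
    case True
    then have "s + j - 2 = m - 2" using sm s2 by simp
    moreover have "v (m - 2) = {F, G (m - 2), G (m - 1)}"
      using v_Suc[of "m - 2"] sm by (simp add: Suc_diff_Suc numeral_2_eq_2)
    ultimately show ?thesis using True that sm by (simp add: G'_def)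
  next
    case False
    then have "Suc (s + j - 2) < m" using that sm by simp
    moreover have "Suc (s + j - 2) = s + Suc j - 2" using that by simp
    ultimately show ?thesis using False that v_Suc[of "s + j - 2"] by (simp add: G'_def)
  qed
  have sh: "(\<lambda>j. s + j - 2) ` {3..<?m} = {Suc s..<m - 1}"
  proof -
    have "x \<in> (\<lambda>j. s + j - 2) ` {3..<?m}" if "x \<in> {Suc s..<m - 1}" for x
      by (rule image_eqI[of _ _ "x + 2 - s"]) (use that in auto)
    then show ?thesis using sm s2 by auto
  qed
  have "?f ` {3..<?m} = (\<lambda>j. v (s + j - 2)) ` {3..<?m}" using e3 by (intro image_cong) auto
  also have "\<dots> = v ` {Suc s..<m - 1}" unfolding sh[symmetric] image_image by (rule refl)
  finally have e3: "?f ` {3..<?m} = v ` {Suc s..<m - 1}" .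
  have R: "?f ` {..<?m} = {v (m - 1), {N, F, G 0}, {N, F, G (Suc s)}} \<union> v ` {Suc s..<m - 1}"
    unfolding lt image_Un e3 image_insert e0 e1 e2 by simp
  have ms: "{Suc s..<m} = insert (m - 1) {Suc s..<m - 1}" using sm by auto
  have old: "{t \<in> T. t \<notin> v ` {..s} \<and> F \<in> t} = v ` {Suc s..<m}"
  proof (intro equalityI subsetI)
    fix t assume "t \<in> {t \<in> T. t \<notin> v ` {..s} \<and> F \<in> t}"
    then obtain k where k: "k < m" "t = v k" "t \<notin> v ` {..s}" using T_F by blast
    then have "\<not> k \<le> s" by auto
    then show "t \<in> v ` {Suc s..<m}" using k by simp
  next
    fix t assume "t \<in> v ` {Suc s..<m}"
    then obtain k where k: "Suc s \<le> k" "k < m" "t = v k" by auto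
    then show "t \<in> {t \<in> T. t \<notin> v ` {..s} \<and> F \<in> t}" using v_T F_v v_kept[of k] by simp
  qed
  have "{t \<in> T'. F \<in> t} = {t \<in> T. t \<notin> v ` {..s} \<and> F \<in> t} \<union> {{N, F, G 0}, {N, F, G (Suc s)}}"
  proof -
    have "F \<notin> {N, G i, G (Suc i)}" if "i \<le> s" for i using that N_F G_F[of i] G_F[of "Suc i"] sm by auto
    then show ?thesis unfolding mem_T' by blast
  qed
  also have "\<dots> = ?f ` {..<?m}" unfolding old R ms by auto
  finally show ?thesis using inj FG unfolding link_cycle_def by blast
qed

lemma link_other:
  assumes E: "link_cycle T E k H" "E \<noteq> F" "E \<notin> G ` {..<m}" "E \<noteq> N"
  shows "link_cycle T' E k H"
proof -
  have "E \<notin> t" if "t \<in> v ` {..s}" for t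
    using that E sm by (auto simp: v_def)
  moreover have *: "E \<noteq> G i" if "i \<le> Suc s" for i using E(3) that sm by auto
  then have "E \<notin> {N, G i, G (Suc i)}" if "i \<le> s" for i using that E(4) by auto
  moreover have "E \<notin> {N, F, G 0}" "E \<notin> {N, F, G (Suc s)}" using E * by auto
  ultimately have "{t \<in> T'. E \<in> t} = {t \<in> T. E \<in> t}" unfolding mem_T' by blast
  then show ?thesis using E(1) by (simp add: link_cycle_def)
qed

end

section \<open>The cutting plane\<close>

lemma cross3_plane_line:
  fixes e d w :: "real^3"
  assumes "e \<noteq> 0" "d \<noteq> 0" "e \<bullet> d = 0" "e \<bullet> w = 0" "cross3 e d \<bullet> w = 0"
  shows "\<exists>l. w = l *\<^sub>R d"
proof -
  \<comment> \<open>By this identity \<open>cross3 d w\<close> is parallel to \<open>e\<close>. The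
    triple product shows that it is also orthogonal to \<open>e\<close>, so it vanishes and
    \<open>w\<close> is a multiple of \<open>d\<close>.\<close>
  have "cross3 e (cross3 d w) = 0"
    using Lagrange[of e d w] assms(3,4) by simp
  then have "cross3 d w = 0 \<or> (\<exists>c. cross3 d w = c *\<^sub>R e)"
    using assms(1) by (auto simp: cross_eq_0 collinear_lemma)
  moreover have "e \<bullet> cross3 d w = 0"
    using assms(5) cross_triple[of e d w] by (simp add: inner_commute)
  ultimately have "cross3 d w = 0" using assms(1) by auto
  then show ?thesis using assms(2) by (auto simp: cross_eq_0 collinear_lemma intro: exI[of _ 0])
qed

lemma small_perturbation:
  fixes h g :: "'a \<Rightarrow> real"
  assumes "finite S" "\<And>t. t \<in> S \<Longrightarrow> h t < 0"
  shows "\<exists>e>0. \<forall>t\<in>S. h t + e * g t < 0"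
  using assms
proof (induction S)
  case empty
  then show ?case by (auto intro: exI[of _ 1])
next
  case (insert x S)
  then obtain e where e: "e > 0" "\<And>t. t \<in> S \<Longrightarrow> h t + e * g t < 0" by auto
  \<comment> \<open>The second bound makes \<open>k * \<bar>g x\<bar>\<close> smaller than
    \<open>- h x\<close>; the summand 1 keeps the denominator positive.\<close>
  define k where "k = min e (- h x / (\<bar>g x\<bar> + 1))"
  have hx: "h x < 0" using insert by simp
  have k: "k > 0" "k \<le> e" using e(1) hx by (auto simp: k_def intro!: divide_neg_pos)
  have "h t + k * g t < 0" if "t \<in> S" for t
  proof (cases "g t \<le> 0")
    case True
    then have "k * g t \<le> 0" using k(1) by (simp add: mult_nonneg_nonpos)
    then show ?thesis using insert.prems[of t] that by simp
  next
    case False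
    then have "k * g t \<le> e * g t" using k by (intro mult_right_mono) auto
    then show ?thesis using e(2)[OF that] by simp
  qed
  moreover have "h x + k * g x < 0"
  proof -
    have "k * g x \<le> k * \<bar>g x\<bar>" using k by (intro mult_left_mono) auto
    also have "\<dots> < k * (\<bar>g x\<bar> + 1)" using k by simp
    also have "\<dots> \<le> (- h x / (\<bar>g x\<bar> + 1)) * (\<bar>g x\<bar> + 1)"
      by (intro mult_right_mono) (auto simp: k_def)
    also have "\<dots> = - h x" by simp
    finally show ?thesis by simp
  qed
  ultimately show ?case using k(1) by blast
qed

lemma affine_zero_between:
  fixes u w :: real
  assumes "u * w \<le> 0"
  shows "\<exists>l. 0 \<le> l \<and> l \<le> 1 \<and> (1 - l) * u + l * w = 0"
proof (cases "u = w")
  case True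
  then have "u = 0" using assms by (metis mult_le_0_iff order_antisym zero_le_square)
  then show ?thesis using True by (auto intro: exI[of _ 0])
next
  case False
  show ?thesis
  proof (intro exI[of _ "u / (u - w)"] conjI)
    show "0 \<le> u / (u - w)" "u / (u - w) \<le> 1"
      using assms False by (auto simp: divide_simps mult_le_0_iff)
    show "(1 - u / (u - w)) * u + u / (u - w) * w = 0" using False by (simp add: field_simps)
  qed
qed

locale realized_cut = cut +
  fixes a :: "nat \<Rightarrow> real^3" and b :: "nat \<Rightarrow> real" and p :: "nat set \<Rightarrow> real^3"
  assumes le: "t \<in> T \<Longrightarrow> i \<in> \<Union>T \<Longrightarrow> a i \<bullet> p t \<le> b i"
    and tight: "t \<in> T \<Longrightarrow> i \<in> \<Union>T \<Longrightarrow> a i \<bullet> p t = b i \<longleftrightarrow> i \<in> t"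
begin

definition h :: "nat \<Rightarrow> real^3 \<Rightarrow> real" where "h i z = a i \<bullet> z - b i"

lemma h_aff: "h i ((1 - l) *\<^sub>R x + l *\<^sub>R y) = (1 - l) * h i x + l * h i y"
  by (simp add: h_def inner_add_right algebra_simps)

lemma h_p: "t \<in> T \<Longrightarrow> i \<in> \<Union>T \<Longrightarrow> h i (p t) \<le> 0" "t \<in> T \<Longrightarrow> i \<in> \<Union>T \<Longrightarrow> h i (p t) = 0 \<longleftrightarrow> i \<in> t"
  using le[of t i] tight[of t i] by (auto simp: h_def)

text \<open>Both terms of the convex combination are at most 0, so the sum vanishes only where both
  do, that is, on the facets common to the two ends.\<close>

lemma h_between:
  assumes "t \<in> T" "u \<in> T" "i \<in> \<Union>T" "0 < l" "l < 1"
  shows "h i ((1 - l) *\<^sub>R p t + l *\<^sub>R p u) \<le> 0"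
    and "h i ((1 - l) *\<^sub>R p t + l *\<^sub>R p u) = 0 \<longleftrightarrow> i \<in> t \<inter> u"
proof -
  have 1: "(1 - l) * h i (p t) \<le> 0" "l * h i (p u) \<le> 0"
    using h_p assms by (auto simp: mult_nonneg_nonpos)
  then show "h i ((1 - l) *\<^sub>R p t + l *\<^sub>R p u) \<le> 0" unfolding h_aff by simp
  have "h i ((1 - l) *\<^sub>R p t + l *\<^sub>R p u) = 0 \<longleftrightarrow> (1 - l) * h i (p t) = 0 \<and> l * h i (p u) = 0"
    unfolding h_aff using 1 by linarith
  then show "h i ((1 - l) *\<^sub>R p t + l *\<^sub>R p u) = 0 \<longleftrightarrow> i \<in> t \<inter> u"
    using h_p(2)[of t i] h_p(2)[of u i] assms by auto
qed

lemma F_I: "F \<in> \<Union>T"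
  using v_T[of 0] F_v[of 0] sm by auto

lemma G_I: "i < m \<Longrightarrow> G i \<in> \<Union>T"
  using v_T[of i] unfolding v_def by blast

text \<open>\<open>X\<close> and \<open>Y\<close> are the midpoints of the edges that
  \<open>F\<close> shares with \<open>G 0\<close> and \<open>G (Suc s)\<close>. They become the ends
  of the new edge of \<open>F\<close> once the plane is tilted about the line joining them.\<close>

definition X :: "real^3" where "X = (1 - 1/2) *\<^sub>R p (v (m - 1)) + (1/2) *\<^sub>R p (v 0)"
definition Y :: "real^3" where "Y = (1 - 1/2) *\<^sub>R p (v s) + (1/2) *\<^sub>R p (v (Suc s))"

lemma h_X: "i \<in> \<Union>T \<Longrightarrow> h i X \<le> 0" "i \<in> \<Union>T \<Longrightarrow> h i X = 0 \<longleftrightarrow> i = F \<or> i = G 0"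
proof -
  have "v (m - 1) \<inter> v 0 = {F, G 0}"
    using v_last v_Suc[of 0] G_eq[of 1 "m - 1"] G_eq[of 1 0] G_F[of "m - 1"] G_F[of 1] sm by auto
  then show "i \<in> \<Union>T \<Longrightarrow> h i X \<le> 0" "i \<in> \<Union>T \<Longrightarrow> h i X = 0 \<longleftrightarrow> i = F \<or> i = G 0"
    unfolding X_def using h_between[OF v_T v_T, of "m - 1" 0 i "1/2"] sm by auto
qed

lemma h_Y: "i \<in> \<Union>T \<Longrightarrow> h i Y \<le> 0" "i \<in> \<Union>T \<Longrightarrow> h i Y = 0 \<longleftrightarrow> i = F \<or> i = G (Suc s)"
proof -
  have "v s \<inter> v (Suc s) = {F, G (Suc s)}"
    using v_Suc[of s] v_Suc[of "Suc s"] G_eq[of s "Suc s"] G_eq[of s "Suc (Suc s)"] G_F[of s] G_F[of "Suc (Suc s)"] sm by auto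
  then show "i \<in> \<Union>T \<Longrightarrow> h i Y \<le> 0" "i \<in> \<Union>T \<Longrightarrow> h i Y = 0 \<longleftrightarrow> i = F \<or> i = G (Suc s)"
    unfolding Y_def using h_between[OF v_T v_T, of s "Suc s" i "1/2"] sm by auto
qed

text \<open>\<open>n\<close> is orthogonal to \<open>a F\<close> and to \<open>Y - X\<close>, so the
  plane \<open>g = 0\<close> is perpendicular to that of \<open>F\<close> and meets it exactly in
  the line through \<open>X\<close> and \<open>Y\<close>.\<close>

definition n :: "real^3" where "n = cross3 (a F) (Y - X)"
definition g :: "real^3 \<Rightarrow> real" where "g z = n \<bullet> (z - X)"

lemma g_aff: "g ((1 - l) *\<^sub>R x + l *\<^sub>R y) = (1 - l) * g x + l * g y"
  by (simp add: g_def inner_add_right inner_diff_right algebra_simps)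

lemma on_line:
  assumes "h F z = 0" "g z = 0" shows "\<exists>l. z = (1 - l) *\<^sub>R X + l *\<^sub>R Y"
proof -
  have hF: "h F X = 0" "h F Y = 0" using h_X h_Y F_I by blast+
  have "a F \<noteq> 0"
  proof
    assume "a F = 0"
    then have "h F z = h F (p t)" for t by (simp add: h_def)
    then have all: "F \<in> t" if "t \<in> T" for t using h_p(2)[OF that F_I] assms(1) by simp
    obtain t' where t': "t' \<in> T" "v 0 \<inter> t' = v 0 - {F}"
      using pog_edge[OF pog v_T[of 0] F_v] sm by auto
    show False using all[OF t'(1)] t'(2) F_v[of 0] by blast
  qed
  moreover have "Y - X \<noteq> 0"
    using h_X(2)[OF G_I[of 0]] h_Y(2)[OF G_I[of 0]] G_F[of 0] G_eq[of 0 "Suc s"] sm by auto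
  moreover have "a F \<bullet> (Y - X) = 0" "a F \<bullet> (z - X) = 0"
    using hF assms by (simp_all add: h_def inner_diff_right)
  ultimately obtain l where "z - X = l *\<^sub>R (Y - X)"
    using cross3_plane_line[of "a F" "Y - X" "z - X"] assms(2) by (auto simp: g_def n_def)
  then have "z = (1 - l) *\<^sub>R X + l *\<^sub>R Y" by (simp add: algebra_simps)
  then show ?thesis by blast
qed

lemma h_F_v: "i < m \<Longrightarrow> h F (p (v i)) = 0"
  using h_p(2)[OF v_T F_I] F_v by blast

text \<open>The line through \<open>X\<close> and \<open>Y\<close> meets the boundary of the facet \<open>F\<close> only in these two points,
  so the two ends of any other edge of \<open>F\<close> lie strictly on the same side of it.\<close>

lemma same_side:
  assumes i: "Suc i < m" "i \<noteq> s"
  shows "g (p (v i)) * g (p (v (Suc i))) > 0"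
proof (rule ccontr)
  assume "\<not> ?thesis"
  then obtain l where l: "0 \<le> l" "l \<le> 1" "(1 - l) * g (p (v i)) + l * g (p (v (Suc i))) = 0"
    using affine_zero_between[of "g (p (v i))" "g (p (v (Suc i)))"] by auto
  define z where "z = (1 - l) *\<^sub>R p (v i) + l *\<^sub>R p (v (Suc i))"
  have "h F z = 0" unfolding z_def h_aff using h_F_v i by simp
  moreover have "g z = 0" unfolding z_def g_aff using l(3) .
  ultimately obtain k where k: "z = (1 - k) *\<^sub>R X + k *\<^sub>R Y" using on_line by blast
  have z0: "h j z \<le> 0" if "j \<in> \<Union>T" for j
  proof -
    have "(1 - l) * h j (p (v i)) \<le> 0" "l * h j (p (v (Suc i))) \<le> 0"
      using h_p(1)[OF v_T that, of i] h_p(1)[OF v_T that, of "Suc i"] i l by (auto simp: mult_nonneg_nonpos)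
    then show ?thesis unfolding z_def h_aff by simp
  qed
  have G0s: "G 0 \<noteq> G (Suc s)" "G 0 \<noteq> F" "G (Suc s) \<noteq> F" using G_eq[of 0 "Suc s"] G_F sm by auto
  have I: "G 0 \<in> \<Union>T" "G (Suc s) \<in> \<Union>T" "G (Suc i) \<in> \<Union>T" using G_I i(1) sm by auto
  \<comment> \<open>\<open>z\<close> belongs to the segment from \<open>X\<close> to
    \<open>Y\<close>: the inequality of \<open>G 0\<close>, tight at \<open>X\<close> and strict at
    \<open>Y\<close>, forces \<open>k \<ge> 0\<close>, and that of \<open>G (Suc s)\<close> forces
    \<open>k \<le> 1\<close> in the same way.\<close>
  have "h (G 0) X = 0" "h (G 0) Y < 0"
    using h_X(2)[OF I(1)] h_Y[OF I(1)] G0s by (auto simp: order_less_le)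
  moreover have "(1 - k) * h (G 0) X + k * h (G 0) Y \<le> 0" using z0[OF I(1)] unfolding k h_aff .
  ultimately have k0: "k \<ge> 0" by (simp add: mult_le_0_iff)
  have "h (G (Suc s)) Y = 0" "h (G (Suc s)) X < 0"
    using h_Y(2)[OF I(2)] h_X[OF I(2)] G0s by (auto simp: order_less_le)
  moreover have "(1 - k) * h (G (Suc s)) X + k * h (G (Suc s)) Y \<le> 0" using z0[OF I(2)] unfolding k h_aff .
  ultimately have k1: "k \<le> 1" by (simp add: mult_le_0_iff)
  \<comment> \<open>\<open>G (Suc i)\<close> contains the whole edge and therefore \<open>z\<close>,
    but it differs from the facets at \<open>X\<close> and \<open>Y\<close>, so its inequality is
    strict on the segment.\<close>
  have ne: "G (Suc i) \<noteq> G 0" "G (Suc i) \<noteq> G (Suc s)" "G (Suc i) \<noteq> F"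
    using G_eq[of "Suc i" 0] G_eq[of "Suc i" "Suc s"] G_F i sm by auto
  have neg: "h (G (Suc i)) X < 0" "h (G (Suc i)) Y < 0"
    using h_X[OF I(3)] h_Y[OF I(3)] ne by (auto simp: order_less_le)
  have Gv: "G (Suc i) \<in> v i" "G (Suc i) \<in> v (Suc i)" using i by (auto simp: v_def)
  have "h (G (Suc i)) (p (v i)) = 0" "h (G (Suc i)) (p (v (Suc i))) = 0"
    using h_p(2)[OF v_T[of i] I(3)] h_p(2)[OF v_T[of "Suc i"] I(3)] i Gv by simp_all
  then have "h (G (Suc i)) z = 0" unfolding z_def h_aff by simp
  then have "(1 - k) * h (G (Suc i)) X + k * h (G (Suc i)) Y = 0" unfolding k h_aff .
  then show False using k0 k1 neg
    by (smt (verit) mult_nonneg_nonpos mult_pos_neg)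
qed

text \<open>\<open>g\<close> is affine and vanishes at the midpoint \<open>X\<close> of the edge. If
  it vanished at \<open>v 0\<close> as well, this vertex would be on the line and on
  \<open>G 0\<close>, hence equal to \<open>X\<close>, which is not on \<open>G 1\<close>.\<close>

lemma opposite_sides: "g (p (v (m - 1))) = - g (p (v 0))" "g (p (v 0)) \<noteq> 0"
proof -
  have "g X = 0" by (simp add: g_def)
  then show "g (p (v (m - 1))) = - g (p (v 0))" unfolding X_def g_aff by simp
  show "g (p (v 0)) \<noteq> 0"
  proof
    assume "g (p (v 0)) = 0"
    moreover have "h F (p (v 0)) = 0" using h_F_v sm by simp
    ultimately obtain k where k: "p (v 0) = (1 - k) *\<^sub>R X + k *\<^sub>R Y" using on_line by blast
    have I: "G 0 \<in> \<Union>T" "G 1 \<in> \<Union>T" using G_I sm by auto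
    have vt: "v 0 \<in> T" using v_T sm by simp
    have "h (G 0) X = 0" "h (G 0) Y \<noteq> 0"
      using h_X(2)[OF I(1)] h_Y[OF I(1)] G_eq[of 0 "Suc s"] G_F[of 0] sm by auto
    moreover have "h (G 0) (p (v 0)) = 0" using h_p(2)[OF vt I(1)] by (simp add: v_def)
    ultimately have "k = 0" unfolding k h_aff by simp
    then have "p (v 0) = X" using k by simp
    moreover have "h (G 1) (p (v 0)) = 0" using h_p(2)[OF vt I(2)] v_Suc[of 0] sm by simp
    ultimately show False using h_X(2)[OF I(2)] G_eq[of 1 0] G_F[of 1] sm by auto
  qed
qed

lemma side_cut: "i \<le> s \<Longrightarrow> g (p (v i)) * g (p (v 0)) > 0"
proof (induction i)
  case 0
  then show ?case using opposite_sides(2) by (auto simp: zero_less_mult_iff neq_iff)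
next
  case (Suc i)
  then have "g (p (v i)) * g (p (v 0)) > 0" by simp
  moreover have "g (p (v i)) * g (p (v (Suc i))) > 0" using same_side[of i] Suc sm by simp
  ultimately show ?case by (auto simp: zero_less_mult_iff)
qed

text \<open>Running backwards from \<open>v (m - 1)\<close> to \<open>v (Suc s)\<close> avoids the
  edge between \<open>v s\<close> and \<open>v (Suc s)\<close>, where the sign changes.\<close>

lemma side_kept: "k < m - Suc s \<Longrightarrow> g (p (v (m - 1 - k))) * g (p (v 0)) < 0"
proof (induction k)
  case 0
  then show ?case using opposite_sides by (auto simp: mult_less_0_iff zero_less_mult_iff neq_iff)
next
  case (Suc k)
  then have "g (p (v (m - 1 - k))) * g (p (v 0)) < 0" by simp
  moreover have "g (p (v (m - 1 - Suc k))) * g (p (v (m - 1 - k))) > 0"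
    using same_side[of "m - 1 - Suc k"] Suc.prems sm by (simp add: Suc_diff_Suc)
  ultimately show ?case by (auto simp: zero_less_mult_iff mult_less_0_iff)
qed

text \<open>Adding a small multiple of \<open>r * g\<close> to the inequality of \<open>F\<close>
  tilts its plane about the line through \<open>X\<close> and \<open>Y\<close>. On \<open>F\<close>
  the sign of \<open>r * g\<close> decides, positive at the cut vertices and negative at the others;
  off \<open>F\<close> the strict inequality survives a small tilt.\<close>

lemma separating_plane:
  "\<exists>c d. (\<forall>i\<le>s. c \<bullet> p (v i) > d) \<and> (\<forall>t\<in>T. t \<notin> v ` {..s} \<longrightarrow> c \<bullet> p t < d)"
proof -
  define r where "r = g (p (v 0))"
  have "finite {t \<in> T. F \<notin> t}" using pog_finite[OF pog] by simp
  moreover have "h F (p t) < 0" if "t \<in> {t \<in> T. F \<notin> t}" for t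
    using h_p[OF _ F_I, of t] that by (auto simp: order_less_le)
  ultimately obtain e where e: "e > 0" "\<And>t. t \<in> T \<Longrightarrow> F \<notin> t \<Longrightarrow> h F (p t) + e * (r * g (p t)) < 0"
    using small_perturbation[of "{t \<in> T. F \<notin> t}" "\<lambda>t. h F (p t)" "\<lambda>t. r * g (p t)"] by auto
  define c where "c = a F + (e * r) *\<^sub>R n"
  define d where "d = b F + (e * r) * (n \<bullet> X)"
  have cd: "c \<bullet> z - d = h F z + e * (r * g z)" for z
    by (simp add: c_def d_def h_def g_def inner_add_left inner_diff_right algebra_simps)
  have "c \<bullet> p (v i) > d" if "i \<le> s" for i
  proof -
    have "h F (p (v i)) = 0" using h_F_v that sm by simp
    moreover have "e * (r * g (p (v i))) > 0"
      using side_cut[OF that] e(1) by (simp add: r_def mult.commute)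
    ultimately show ?thesis using cd[of "p (v i)"] by simp
  qed
  moreover have "c \<bullet> p t < d" if t: "t \<in> T" "t \<notin> v ` {..s}" for t
  proof (cases "F \<in> t")
    case True
    then obtain k where k: "k < m" "t = v k" using T_F t by blast
    then have "\<not> k \<le> s" using t(2) by auto
    then have "g (p (v k)) * r < 0"
      using side_kept[of "m - 1 - k"] k(1) by (simp add: r_def)
    then have "e * (r * g (p t)) < 0" using e(1) k(2) by (simp add: mult_less_0_iff mult.commute)
    moreover have "h F (p t) = 0" using h_F_v k by simp
    ultimately show ?thesis using cd[of "p t"] by simp
  next
    case False
    then show ?thesis using e(2)[OF t(1) False] cd[of "p t"] by simp
  qed
  ultimately show ?thesis by blast
qed

text \<open>The old planes are kept. Each vertex with \<open>N\<close> is placed where an edge with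
  ends on different sides crosses the new plane, so it is tight for \<open>N\<close> and for the
  facets containing that edge.\<close>

lemma realizable': "realizable T'"
proof -
  obtain c d where "\<forall>i\<le>s. c \<bullet> p (v i) > d" "\<forall>t\<in>T. t \<notin> v ` {..s} \<longrightarrow> c \<bullet> p t < d"
    using separating_plane by (elim exE conjE)
  note cd = this[rule_format]
  define a' where "a' = a(N := c)"
  define b' where "b' = b(N := d)"
  have old: "a' i \<bullet> z \<le> b' i \<longleftrightarrow> h i z \<le> 0" "a' i \<bullet> z = b' i \<longleftrightarrow> h i z = 0" if "i \<in> \<Union>T" for i z
    using that N by (auto simp: a'_def b'_def h_def)
  have new: "a' N = c" "b' N = d" by (auto simp: a'_def b'_def)
  have crossing: "\<exists>x. \<forall>i\<in>insert N (\<Union>T). a' i \<bullet> x \<le> b' i \<and> (a' i \<bullet> x = b' i \<longleftrightarrow> i \<in> insert N (t \<inter> u))"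
    if tu: "t \<in> T" "u \<in> T" "c \<bullet> p t > d" "c \<bullet> p u < d" for t u
  proof -
    define l where "l = (c \<bullet> p t - d) / (c \<bullet> p t - c \<bullet> p u)"
    have l: "0 < l" "l < 1" using tu(3,4) by (auto simp: l_def)
    define x where "x = (1 - l) *\<^sub>R p t + l *\<^sub>R p u"
    have "c \<bullet> x = c \<bullet> p t - l * (c \<bullet> p t - c \<bullet> p u)"
      by (simp add: x_def inner_add_right algebra_simps)
    also have "\<dots> = d" using tu(3,4) by (simp add: l_def)
    finally have "c \<bullet> x = d" .
    moreover have "h i x \<le> 0" "h i x = 0 \<longleftrightarrow> i \<in> t \<inter> u" if "i \<in> \<Union>T" for i
      using h_between[OF tu(1,2) that l] by (auto simp: x_def)
    ultimately have "a' i \<bullet> x \<le> b' i \<and> (a' i \<bullet> x = b' i \<longleftrightarrow> i \<in> insert N (t \<inter> u))"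
      if "i \<in> insert N (\<Union>T)" for i
      using that old[of i x] new N by (cases "i = N") auto
    then show ?thesis by (intro exI[of _ x] ballI)
  qed
  have "\<exists>x. \<forall>i\<in>\<Union>T'. a' i \<bullet> x \<le> b' i \<and> (a' i \<bullet> x = b' i \<longleftrightarrow> i \<in> t')" if t': "t' \<in> T'" for t'
  proof -
    from t' consider "t' \<in> T" "t' \<notin> v ` {..s}" | i where "i \<le> s" "t' = {N, G i, G (Suc i)}"
      | "t' = {N, F, G 0}" | "t' = {N, F, G (Suc s)}" unfolding mem_T' by blast
    then show ?thesis unfolding Union'
    proof cases
      case 1
      have "a' i \<bullet> p t' \<le> b' i \<and> (a' i \<bullet> p t' = b' i \<longleftrightarrow> i \<in> t')" if i: "i \<in> insert N (\<Union>T)" for i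
      proof (cases "i = N")
        case True
        then show ?thesis using cd(2)[OF 1] new N_T[OF 1(1)] by simp
      next
        case False
        then show ?thesis using old[of i "p t'"] h_p[OF 1(1), of i] i by simp
      qed
      then show "\<exists>x. \<forall>i\<in>insert N (\<Union>T). a' i \<bullet> x \<le> b' i \<and> (a' i \<bullet> x = b' i \<longleftrightarrow> i \<in> t')"
        by (intro exI[of _ "p t'"] ballI)
    next
      case (2 i)
      have vi: "v i \<in> T" "v i = {F, G i, G (Suc i)}" using v_T[of i] v_Suc[of i] 2(1) sm by auto
      obtain u where u: "u \<in> T" "v i \<inter> u = v i - {F}" using pog_edge[OF pog vi(1) F_v] by blast
      have "F \<notin> u" using u(2) F_v[of i] by blast
      then have "u \<notin> v ` {..s}" using F_v by blast
      moreover have "insert N (v i \<inter> u) = t'"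
        using 2 u(2) vi(2) G_F[of i] G_F[of "Suc i"] sm by auto
      ultimately show "\<exists>x. \<forall>i\<in>insert N (\<Union>T). a' i \<bullet> x \<le> b' i \<and> (a' i \<bullet> x = b' i \<longleftrightarrow> i \<in> t')"
        using crossing[OF vi(1) u(1) cd(1)[OF 2(1)] cd(2)[OF u(1)]] by simp
    next
      case 3
      have "v 0 \<inter> v (m - 1) = {F, G 0}"
        using v_last v_Suc[of 0] G_eq[of 1 "m - 1"] G_eq[of 1 0] G_F[of "m - 1"] G_F[of 1] sm by auto
      then have "insert N (v 0 \<inter> v (m - 1)) = t'" using 3 by simp
      moreover have "v 0 \<in> T" "v (m - 1) \<in> T" "v (m - 1) \<notin> v ` {..s}"
        using v_T v_kept[of "m - 1"] sm by auto
      ultimately show "\<exists>x. \<forall>i\<in>insert N (\<Union>T). a' i \<bullet> x \<le> b' i \<and> (a' i \<bullet> x = b' i \<longleftrightarrow> i \<in> t')"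
        using crossing[of "v 0" "v (m - 1)"] cd(1)[of 0] cd(2)[of "v (m - 1)"] by simp
    next
      case 4
      have "v s \<inter> v (Suc s) = {F, G (Suc s)}"
        using v_Suc[of s] v_Suc[of "Suc s"] G_eq[of s "Suc s"] G_eq[of s "Suc (Suc s)"] G_F[of s] G_F[of "Suc (Suc s)"] sm by auto
      then have "insert N (v s \<inter> v (Suc s)) = t'" using 4 by simp
      moreover have "v s \<in> T" "v (Suc s) \<in> T" "v (Suc s) \<notin> v ` {..s}"
        using v_T v_kept[of "Suc s"] sm by auto
      ultimately show "\<exists>x. \<forall>i\<in>insert N (\<Union>T). a' i \<bullet> x \<le> b' i \<and> (a' i \<bullet> x = b' i \<longleftrightarrow> i \<in> t')"
        using crossing[of "v s" "v (Suc s)"] cd(1)[of s] cd(2)[of "v (Suc s)"] by simp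
    qed
  qed
  then show ?thesis unfolding realizable_def by (intro exI[of _ a'] exI[of _ b'] ballI)
qed

end

lemma (in cut) realizable_cut:
  assumes "realizable T" shows "realizable T'"
proof -
  obtain a :: "nat \<Rightarrow> real^3" and b where "\<forall>t\<in>T. \<exists>x. \<forall>i\<in>\<Union>T. a i \<bullet> x \<le> b i \<and> (a i \<bullet> x = b i \<longleftrightarrow> i \<in> t)"
    using assms unfolding realizable_def by (elim exE)
  from bchoice[OF this] obtain p where p: "\<forall>t\<in>T. \<forall>i\<in>\<Union>T. a i \<bullet> p t \<le> b i \<and> (a i \<bullet> p t = b i \<longleftrightarrow> i \<in> t)"
    by (elim exE)
  interpret realized_cut T F m G s N a b p
  proof
    show "a i \<bullet> p t \<le> b i" "(a i \<bullet> p t = b i) = (i \<in> t)" if "t \<in> T" "i \<in> \<Union>T" for t i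
      using p that by blast+
  qed
  show ?thesis by (rule realizable')
qed

subsection \<open>Barrels\<close>

locale barrel =
  fixes M :: nat
  assumes M: "6 \<le> M"
begin

text \<open>The pentagons are numbered in zigzag around the barrel: even numbers border the top
  \<open>2 * M\<close>, odd ones the bottom \<open>2 * M + 1\<close>, and two pentagons are adjacent
  when their numbers differ by 1 or 2 modulo \<open>2 * M\<close>. Integer arguments admit negative
  shifts.\<close>

definition r :: "int \<Rightarrow> nat" where "r j = nat (j mod (2 * int M))"
definition cap :: "int \<Rightarrow> nat" where "cap j = (if even j then 2 * M else 2 * M + 1)"
definition rt :: "int \<Rightarrow> nat set" where "rt j = {r j, r (j + 1), r (j + 2)}"
definition ct :: "int \<Rightarrow> nat set" where "ct j = {cap j, r j, r (j + 2)}"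
definition B :: "nat set set" where "B = range rt \<union> range ct"

lemma r_lt: "r j < 2 * M"
  using M pos_mod_bound[of "2 * int M" j] pos_mod_sign[of "2 * int M" j] unfolding r_def by linarith

lemma r_iff: "r j = r k \<longleftrightarrow> 2 * int M dvd j - k"
proof -
  have "j mod (2 * int M) \<ge> 0" "k mod (2 * int M) \<ge> 0" using M by simp_all
  then show ?thesis unfolding r_def by (simp add: mod_eq_dvd_iff nat_eq_iff2 dvd_diff_commute)
qed

lemma r_shift: "r j = r k \<Longrightarrow> r (j + d) = r (k + d)"
  by (simp add: r_iff)

text \<open>The period is at least 12 because \<open>M \<ge> 6\<close>, so nearby indices can be
  compared as integers.\<close>

lemma r_near [simp]: "\<bar>j - k\<bar> < 12 \<Longrightarrow> r j = r k \<longleftrightarrow> j = k"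
  using M zdvd_imp_le[of "2 * int M" "\<bar>j - k\<bar>"] by (auto simp: r_iff)

lemma r_even: "r j = r k \<Longrightarrow> even j \<longleftrightarrow> even k"
proof -
  assume "r j = r k"
  then have "2 dvd j - k" unfolding r_iff by (metis dvd_mult_left)
  then show ?thesis by presburger
qed

lemma r_int: "i < 2 * M \<Longrightarrow> r (int i) = i"
  by (simp add: r_def)

lemma cap_r [simp]: "cap j \<noteq> r k" "r k \<noteq> cap j"
  using r_lt[of k] by (auto simp: cap_def)

lemma cap_eq: "cap j = cap k \<longleftrightarrow> (even j \<longleftrightarrow> even k)"
  by (auto simp: cap_def)

lemma rt_B [intro]: "rt j \<in> B" and ct_B [intro]: "ct j \<in> B"
  by (auto simp: B_def)

lemma B_cases: "t \<in> B \<Longrightarrow> (\<exists>j. t = rt j) \<or> (\<exists>j. t = ct j)"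
  by (auto simp: B_def)

lemma rt_shift: "r j = r k \<Longrightarrow> rt j = rt k" and ct_shift: "r j = r k \<Longrightarrow> ct j = ct k"
  using r_shift[of j k] r_even[of j k] by (simp_all add: rt_def ct_def cap_def)

lemma mem_B: "x \<in> \<Union>B \<Longrightarrow> (\<exists>k. x = r k) \<or> (\<exists>k. x = cap k)"
  unfolding B_def rt_def ct_def by blast

lemma Union_B: "\<Union>B = {..<2 * M + 2}"
proof (intro equalityI subsetI)
  fix x assume "x \<in> \<Union>B"
  then consider k where "x = r k" | k where "x = cap k" using mem_B by blast
  then show "x \<in> {..<2 * M + 2}"
  proof cases
    case (1 k) then show ?thesis using r_lt[of k] by simp
  next
    case (2 k) then show ?thesis by (simp add: cap_def)
  qed
next
  fix x assume x: "x \<in> {..<2 * M + 2}"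
  then consider "x < 2 * M" | "x = cap 0" | "x = cap 1" by (force simp: cap_def)
  then show "x \<in> \<Union>B"
  proof cases
    case 1
    then have "x \<in> rt (int x)" by (simp add: rt_def r_int)
    then show ?thesis by blast
  next
    case 2 then have "x \<in> ct 0" by (simp add: ct_def)
    then show ?thesis by blast
  next
    case 3 then have "x \<in> ct 1" by (simp add: ct_def)
    then show ?thesis by blast
  qed
qed

lemma adj_ring: "adj B (r i) (r k) \<longleftrightarrow> (\<exists>d\<in>{1, 2, -1, -2}. r k = r (i + d))"
proof
  assume "adj B (r i) (r k)"
  then obtain t where t: "t \<in> B" "r i \<in> t" "r k \<in> t" "r i \<noteq> r k" by (auto simp: adj_def)
  from B_cases[OF t(1)] obtain j where "t \<subseteq> {r j, r (j + 1), r (j + 2), cap j}"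
    by (auto simp: rt_def ct_def)
  then have "\<exists>x\<in>{0, 1, 2}. r l = r (j + x)" if "r l \<in> t" for l
    using that by auto
  then obtain x y where xy: "x \<in> {0, 1, 2}" "y \<in> {0, 1, 2}" "r i = r (j + x)" "r k = r (j + y)"
    using t(2,3) by meson
  have "r k = r (i + (y - x))"
    using r_shift[OF xy(3), of "y - x"] xy(4) by (simp add: algebra_simps)
  moreover have "x \<noteq> y" using xy(3,4) t(4) by auto
  then have "y - x \<in> {1, 2, -1, -2}" using xy(1,2) by auto
  ultimately show "\<exists>d\<in>{1, 2, -1, -2}. r k = r (i + d)" by blast
next
  assume "\<exists>d\<in>{1, 2, -1, -2}. r k = r (i + d)"
  then obtain d where d: "d \<in> {1, 2, -1, -2}" "r k = r (i + d)" by blast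
  then consider "d = 1" | "d = 2" | "d = -1" | "d = -2" by blast
  then show "adj B (r i) (r k)" unfolding d(2)
  proof cases
    case 1 then show "adj B (r i) (r (i + d))" using adjI[OF rt_B[of i]] by (simp add: rt_def)
  next
    case 2 then show "adj B (r i) (r (i + d))" using adjI[OF rt_B[of i]] by (simp add: rt_def)
  next
    case 3 then show "adj B (r i) (r (i + d))" using adjI[OF rt_B[of "i - 1"]] by (simp add: rt_def)
  next
    case 4 then show "adj B (r i) (r (i + d))" using adjI[OF rt_B[of "i - 2"]] by (simp add: rt_def)
  qed
qed

text \<open>The bound 10 leaves room for a further shift by at most 2 within the range of
  \<open>r_near\<close>.\<close>

lemma adj_near:
  assumes "\<bar>e\<bar> < 10" shows "adj B (r i) (r (i + e)) \<longleftrightarrow> e \<in> {1, 2, -1, -2}"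
  using assms unfolding adj_ring by auto

lemma adj_cap: "adj B (cap j) x \<longleftrightarrow> (\<exists>k. (even k \<longleftrightarrow> even j) \<and> x = r k)"
proof
  assume "adj B (cap j) x"
  then obtain t where t: "t \<in> B" "cap j \<in> t" "x \<in> t" "x \<noteq> cap j" by (auto simp: adj_def)
  from B_cases[OF t(1)] show "\<exists>k. (even k \<longleftrightarrow> even j) \<and> x = r k"
  proof (elim disjE exE)
    fix k assume "t = rt k" then show ?thesis using t(2) by (simp add: rt_def)
  next
    fix k assume k: "t = ct k"
    then have "cap j = cap k" using t(2) by (simp add: ct_def)
    then have e: "even j \<longleftrightarrow> even k" by (simp add: cap_eq)
    have "x = r k \<or> x = r (k + 2)" using k t(3,4) \<open>cap j = cap k\<close> by (auto simp: ct_def)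
    then show ?thesis using e by (metis even_add even_numeral)
  qed
next
  assume "\<exists>k. (even k \<longleftrightarrow> even j) \<and> x = r k"
  then obtain k where "even k \<longleftrightarrow> even j" "x = r k" by blast
  then have "cap j \<in> ct k" "x \<in> ct k" "cap j \<noteq> x" by (auto simp: ct_def cap_eq)
  then show "adj B (cap j) x" using adjI[OF ct_B] by blast
qed

lemma adj_cap_ring: "adj B (cap j) (r k) \<longleftrightarrow> (even k \<longleftrightarrow> even j)"
  unfolding adj_cap using r_even by blast

lemma adj_B_cases: "adj B x y \<Longrightarrow> (\<exists>k. x = r k) \<or> (\<exists>k. x = cap k)"
  using mem_B unfolding adj_def by blast

text \<open>Neighbours of a cap have equal parity, so two adjacent ones differ by 2 or -2 and share
  a vertex with the cap.\<close>

lemma triangle_cap: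
  assumes "adj B (cap j) y" "adj B y z" "adj B (cap j) z" shows "{cap j, y, z} \<in> B"
proof -
  obtain k l where kl: "y = r k" "even k \<longleftrightarrow> even j" "z = r l" "even l \<longleftrightarrow> even j"
    using assms(1,3) unfolding adj_cap by blast
  obtain d where d: "d \<in> {1, 2, -1, -2}" "r l = r (k + d)"
    using assms(2) unfolding kl adj_ring by blast
  have "even d" using r_even[OF d(2)] kl by auto
  then have "d = 2 \<or> d = -2" using d(1) by auto
  then show ?thesis
  proof
    assume "d = 2"
    then have "{cap j, y, z} = ct k" using kl d(2) by (simp add: ct_def cap_def)
    then show ?thesis by auto
  next
    assume "d = -2"
    then have "{cap j, y, z} = ct (k - 2)" using kl d(2) by (simp add: ct_def cap_def insert_commute)
    then show ?thesis by auto
  qed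
qed

lemma triangle_B:
  assumes "adj B x y" "adj B y z" "adj B x z" shows "{x, y, z} \<in> B"
proof -
  have "adj B z x" using assms adj_sym by blast
  then consider j where "x = cap j" | j where "y = cap j" | j where "z = cap j"
    | i j k where "x = r i" "y = r j" "z = r k" using adj_B_cases assms by metis
  then show ?thesis
  proof cases
    case 1 then show ?thesis using triangle_cap assms by blast
  next
    case (2 j)
    then have "{cap j, x, z} \<in> B" using triangle_cap assms adj_sym by blast
    then show ?thesis using 2 by (simp add: insert_commute)
  next
    case (3 j)
    then have "{cap j, x, y} \<in> B" using triangle_cap assms adj_sym by blast
    then show ?thesis using 3 by (simp add: insert_commute)
  next
    case (4 i j k)
    note x = 4(1)
    obtain d where d: "d \<in> {1, 2, -1, -2}" "y = r (i + d)" using assms(1) unfolding 4 adj_ring by blast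
    obtain e where e: "e \<in> {1, 2, -1, -2}" "z = r (i + e)" using assms(3) unfolding 4 adj_ring by blast
    have "adj B (r (i + d)) (r ((i + d) + (e - d)))" using assms(2) d(2) e(2) by simp
    moreover have "\<bar>e - d\<bar> < 10" using d(1) e(1) by auto
    ultimately have "e - d \<in> {1, 2, -1, -2}" using adj_near by blast
    \<comment> \<open>The pairwise differences all have absolute value 1 or 2 only for three
      consecutive numbers.\<close>
    then consider "d = 1" "e = 2" | "d = 2" "e = 1" | "d = 1" "e = -1" | "d = -1" "e = 1"
      | "d = -1" "e = -2" | "d = -2" "e = -1" using d(1) e(1) by auto
    then have "\<exists>k. {x, y, z} = rt k"
    proof cases
      case 1 then show ?thesis unfolding x d(2) e(2) rt_def by (intro exI[of _ i]) simp
    next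
      case 2 then show ?thesis unfolding x d(2) e(2) rt_def by (intro exI[of _ i]) (auto simp: set_eq_iff)
    next
      case 3 then show ?thesis unfolding x d(2) e(2) rt_def by (intro exI[of _ "i - 1"]) (auto simp: set_eq_iff)
    next
      case 4 then show ?thesis unfolding x d(2) e(2) rt_def by (intro exI[of _ "i - 1"]) (auto simp: set_eq_iff)
    next
      case 5 then show ?thesis unfolding x d(2) e(2) rt_def by (intro exI[of _ "i - 2"]) (auto simp: set_eq_iff)
    next
      case 6 then show ?thesis unfolding x d(2) e(2) rt_def by (intro exI[of _ "i - 2"]) (auto simp: set_eq_iff)
    qed
    then show ?thesis by (metis rt_B)
  qed
qed

text \<open>\<open>c\<close> is not the other cap, whose neighbours have the opposite parity. So
  \<open>c = r i\<close>, and \<open>b\<close>, \<open>d\<close> lie at distinct shifts of equal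
  parity from it. Shifts by 2 and -2 leave \<open>b\<close> and \<open>d\<close> apart while
  \<open>c\<close> borders the cap; shifts by 1 and -1 make them adjacent while \<open>c\<close>
  does not border it.\<close>

lemma square_cap:
  assumes "adj B (cap j) b" "adj B b c" "adj B c d" "adj B d (cap j)" "cap j \<noteq> c" "b \<noteq> d"
  shows "adj B (cap j) c \<longleftrightarrow> \<not> adj B b d"
proof -
  have "adj B (cap j) d" using assms(4) adj_sym by blast
  then obtain k l where kl: "b = r k" "even k \<longleftrightarrow> even j" "d = r l" "even l \<longleftrightarrow> even j"
    using assms(1) unfolding adj_cap by blast
  have "\<nexists>i. c = cap i"
  proof
    assume "\<exists>i. c = cap i"
    then obtain i where i: "c = cap i" by blast
    have "adj B (cap i) (r k)" using assms(2) i kl(1) adj_sym by blast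
    then show False using adj_cap_ring kl(2) assms(5) i cap_eq by blast
  qed
  then obtain i where i: "c = r i" using adj_B_cases assms(3) by blast
  have "adj B (r i) (r k)" using assms(2) i kl adj_sym by blast
  then obtain x where x: "x \<in> {1, 2, -1, -2}" "r k = r (i + x)" unfolding adj_ring by blast
  obtain y where y: "y \<in> {1, 2, -1, -2}" "r l = r (i + y)" using assms(3) unfolding i kl adj_ring by blast
  have par: "even (i + x) \<longleftrightarrow> even j" "even (i + y) \<longleftrightarrow> even j"
    using r_even x(2) y(2) kl by blast+
  have "x \<noteq> y" using assms(6) x y kl by auto
  have "adj B b d \<longleftrightarrow> adj B (r (i + x)) (r ((i + x) + (y - x)))" using kl x y by simp
  also have "\<dots> \<longleftrightarrow> y - x \<in> {1, 2, -1, -2}" using x(1) y(1) by (intro adj_near) auto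
  finally have 1: "adj B b d \<longleftrightarrow> y - x \<in> {1, 2, -1, -2}" .
  have 2: "adj B (cap j) c \<longleftrightarrow> (even i \<longleftrightarrow> even j)" unfolding i adj_cap_ring ..
  show ?thesis unfolding 1 2 using par \<open>x \<noteq> y\<close> x(1) y(1) by auto
qed

lemma square_B:
  assumes "adj B a b" "adj B b c" "adj B c d" "adj B d a" "a \<noteq> c" "b \<noteq> d"
  shows "adj B a c \<longleftrightarrow> \<not> adj B b d"
proof -
  consider j where "a = cap j" | j where "b = cap j" | j where "c = cap j" | j where "d = cap j"
    | i j k l where "a = r i" "b = r j" "c = r k" "d = r l" using adj_B_cases assms by metis
  then show ?thesis
  proof cases
    case 1 then show ?thesis using square_cap assms by blast
  next
    case (2 j) then show ?thesis using square_cap[of j c d a] assms adj_sym by metis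
  next
    case (3 j) then show ?thesis using square_cap[of j d a b] assms adj_sym by metis
  next
    case (4 j) then show ?thesis using square_cap[of j a b c] assms adj_sym by metis
  next
    case (5 i j k l)
    obtain x where x: "x \<in> {1, 2, -1, -2}" "b = r (i + x)" using assms(1) unfolding 5 adj_ring by blast
    have "adj B (r i) d" using assms(4) 5 adj_sym by blast
    then obtain y where y: "y \<in> {1, 2, -1, -2}" "d = r (i + y)" unfolding 5 adj_ring by blast
    have "adj B (r (i + x)) c" using assms(2) x(2) by simp
    then obtain z where z: "z \<in> {1, 2, -1, -2}" "c = r (i + x + z)" unfolding 5 adj_ring by blast
    \<comment> \<open>Four steps of size at most 2 cannot wind around the ring, so the last
      difference may be treated as an integer and a finite case check remains.\<close>
    have "adj B (r (i + x + z)) (r (i + x + z + (y - x - z)))" using assms(3) z(2) y(2) by simp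
    then have w: "y - x - z \<in> {1, 2, -1, -2}" using x(1) y(1) z(1) by (subst (asm) adj_near) auto
    have "x + z \<noteq> 0" using assms(5) 5(1) z(2) by (auto simp: add.assoc)
    have "x \<noteq> y" using assms(6) x y by auto
    have "adj B a c \<longleftrightarrow> adj B (r i) (r (i + (x + z)))" using 5 z by (simp add: add.assoc)
    also have "\<dots> \<longleftrightarrow> x + z \<in> {1, 2, -1, -2}" using x(1) z(1) by (intro adj_near) auto
    finally have 1: "adj B a c \<longleftrightarrow> x + z \<in> {1, 2, -1, -2}" .
    have "adj B b d \<longleftrightarrow> adj B (r (i + x)) (r ((i + x) + (y - x)))" using x y by simp
    also have "\<dots> \<longleftrightarrow> y - x \<in> {1, 2, -1, -2}" using x(1) y(1) by (intro adj_near) auto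
    finally have 2: "adj B b d \<longleftrightarrow> y - x \<in> {1, 2, -1, -2}" .
    show ?thesis unfolding 1 2
      using x(1) y(1) z(1) w \<open>x + z \<noteq> 0\<close> \<open>x \<noteq> y\<close>
      by (elim insertE emptyE; simp)
  qed
qed

lemma edge_B:
  assumes "t \<in> B" "i \<in> t" shows "\<exists>t'\<in>B. t \<inter> t' = t - {i}"
proof -
  from B_cases[OF assms(1)] consider j where "t = rt j" | j where "t = ct j" by blast
  then show ?thesis
  proof cases
    case (1 j)
    then consider "i = r j" | "i = r (j + 1)" | "i = r (j + 2)" using assms(2) by (auto simp: rt_def)
    then show ?thesis
    proof cases
      case 1: 1
      have "t \<inter> rt (j + 1) = t - {i}" unfolding 1 \<open>t = rt j\<close> rt_def by auto
      then show ?thesis by blast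
    next
      case 2
      have "t \<inter> ct j = t - {i}" unfolding 2 \<open>t = rt j\<close> rt_def ct_def by auto
      then show ?thesis by blast
    next
      case 3
      have "t \<inter> rt (j - 1) = t - {i}" unfolding 3 \<open>t = rt j\<close> rt_def by auto
      then show ?thesis by blast
    qed
  next
    case (2 j)
    then consider "i = cap j" | "i = r j" | "i = r (j + 2)" using assms(2) by (auto simp: ct_def)
    then show ?thesis
    proof cases
      case 1
      have "t \<inter> rt j = t - {i}" unfolding 1 \<open>t = ct j\<close> rt_def ct_def by auto
      then show ?thesis by blast
    next
      case 2: 2
      have "t \<inter> ct (j + 2) = t - {i}" unfolding 2 \<open>t = ct j\<close> ct_def by (auto simp: cap_eq)
      then show ?thesis by blast
    next
      case 3
      have "t \<inter> ct (j - 2) = t - {i}" unfolding 3 \<open>t = ct j\<close> ct_def by (auto simp: cap_eq)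
      then show ?thesis by blast
    qed
  qed
qed

lemma card_B: "t \<in> B \<Longrightarrow> card t = 3"
  using B_cases[of t] by (auto simp: rt_def ct_def)

lemma pog_B: "pogorelov_complex B"
proof -
  have "B \<subseteq> Pow {..<2 * M + 2}" using Union_B by blast
  then have "finite B" by (rule finite_subset) simp
  moreover have "B \<noteq> {}" using rt_B by blast
  moreover have "\<forall>t\<in>B. card t = 3" using card_B by simp
  moreover have "\<forall>t\<in>B. \<forall>i\<in>t. \<exists>t'\<in>B. t \<inter> t' = t - {i}" using edge_B by simp
  moreover have "\<forall>i j k. adj B i j \<and> adj B j k \<and> adj B i k \<longrightarrow> {i, j, k} \<in> B"
    by (intro allI impI, elim conjE) (rule triangle_B)
  moreover have "\<forall>a b c d. adj B a b \<and> adj B b c \<and> adj B c d \<and> adj B d a \<and> a \<noteq> c \<and> b \<noteq> d \<longrightarrow>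
        (adj B a c \<longleftrightarrow> \<not> adj B b d)"
    by (intro allI impI, elim conjE) (rule square_B)
  ultimately show ?thesis unfolding pogorelov_complex_def by (intro conjI)
qed

lemma deg_ring: "i < 2 * M \<Longrightarrow> deg B i = 5"
proof -
  assume "i < 2 * M"
  then obtain j where j: "i = r j" using r_int by metis
  have "{t \<in> B. r j \<in> t} = {rt j, rt (j - 1), rt (j - 2), ct j, ct (j - 2)}"
  proof (intro equalityI subsetI)
    fix t assume "t \<in> {t \<in> B. r j \<in> t}"
    then have t: "t \<in> B" "r j \<in> t" by auto
    from B_cases[OF t(1)] consider k where "t = rt k" | k where "t = ct k" by blast
    then show "t \<in> {rt j, rt (j - 1), rt (j - 2), ct j, ct (j - 2)}"
    proof cases
      case (1 k)
      then have "r j = r k \<or> r j = r (k + 1) \<or> r j = r (k + 2)" using t(2) by (simp add: rt_def)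
      then have "r j = r k \<or> r (j - 1) = r k \<or> r (j - 2) = r k"
        using r_shift[of j "k + 1" "-1"] r_shift[of j "k + 2" "-2"] by auto
      then show ?thesis using 1 rt_shift[of j k] rt_shift[of "j - 1" k] rt_shift[of "j - 2" k] by auto
    next
      case (2 k)
      then have "r j = r k \<or> r j = r (k + 2)" using t(2) by (simp add: ct_def)
      then have "r j = r k \<or> r (j - 2) = r k" using r_shift[of j "k + 2" "-2"] by auto
      then show ?thesis using 2 ct_shift[of j k] ct_shift[of "j - 2" k] by auto
    qed
  next
    have "r j \<in> rt j" "r j \<in> rt (j - 1)" "r j \<in> rt (j - 2)" "r j \<in> ct j" "r j \<in> ct (j - 2)"
      by (simp_all add: rt_def ct_def)
    then show "t \<in> {t \<in> B. r j \<in> t}" if "t \<in> {rt j, rt (j - 1), rt (j - 2), ct j, ct (j - 2)}" for t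
      using that rt_B ct_B by auto
  qed
  moreover have "card {rt j, rt (j - 1), rt (j - 2), ct j, ct (j - 2)} = 5"
  proof -
    have "r (j + 2) \<in> rt j" "r (j + 2) \<notin> rt (j - 1)" "r (j + 2) \<notin> rt (j - 2)"
      "r (j + 1) \<in> rt (j - 1)" "r (j + 1) \<notin> rt (j - 2)" by (simp_all add: rt_def)
    then have 1: "rt j \<noteq> rt (j - 1)" "rt j \<noteq> rt (j - 2)" "rt (j - 1) \<noteq> rt (j - 2)" by blast+
    have "r (j + 2) \<in> ct j" "r (j + 2) \<notin> ct (j - 2)" by (simp_all add: ct_def)
    then have 2: "ct j \<noteq> ct (j - 2)" by blast
    have "cap k \<in> ct k" "cap k \<notin> rt l" for k l by (simp_all add: ct_def rt_def)
    then have 3: "rt l \<noteq> ct k" for k l by blast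
    show ?thesis using 1 2 3 by simp
  qed
  ultimately show ?thesis by (simp add: deg_def j)
qed

text \<open>Within one ring a step of 2 modulo \<open>2 * M\<close> is a step of 1 modulo
  \<open>M\<close>, the form in which \<open>link_cycle\<close> counts.\<close>

lemma r_double:
  assumes "e \<in> {0, 1}" shows "r (2 * x + int e) = 2 * nat (x mod int M) + e"
proof -
  have "(2 * x + int e) mod (2 * int M) = 2 * (x mod int M) + int e"
  proof (rule int_mod_pos_eq)
    show "2 * x + int e = 2 * int M * (x div int M) + (2 * (x mod int M) + int e)"
      using mult_div_mod_eq[of "int M" x] by (simp only: mult.assoc)
    have "x mod int M < int M" "0 \<le> x mod int M" using M by simp_all
    then show "0 \<le> 2 * (x mod int M) + int e" "2 * (x mod int M) + int e < 2 * int M"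
      using assms by auto
  qed
  moreover have "0 \<le> x mod int M" using M by simp
  ultimately show ?thesis unfolding r_def by (simp add: nat_add_distrib nat_mult_distrib)
qed

lemma link_B:
  assumes e: "e \<in> {0, 1}"
  shows "link_cycle B (2 * M + e) M (\<lambda>i. 2 * i + e)"
proof -
  let ?f = "\<lambda>i. {2 * M + e, 2 * i + e, 2 * (Suc i mod M) + e}"
  have ce: "cap (2 * x + int e) = 2 * M + e" for x using e by (auto simp: cap_def)
  have ct: "ct (2 * x + int e) = ?f (nat (x mod int M))" for x
  proof -
    have "r (2 * x + int e + 2) = 2 * nat ((x + 1) mod int M) + e"
      using r_double[OF e, of "x + 1"] by (simp add: algebra_simps)
    moreover have "nat ((x + 1) mod int M) = Suc (nat (x mod int M)) mod M"
    proof -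
      have "int (Suc (nat (x mod int M)) mod M) = (x mod int M + 1) mod int M"
        using M by (simp add: zmod_int add.commute)
      then show ?thesis by (simp add: mod_add_left_eq nat_eq_iff2)
    qed
    ultimately show ?thesis unfolding ct_def ce using r_double[OF e, of x] by simp
  qed
  have "{t \<in> B. 2 * M + e \<in> t} = ?f ` {..<M}"
  proof (intro equalityI subsetI)
    fix t assume "t \<in> {t \<in> B. 2 * M + e \<in> t}"
    then have t: "t \<in> B" "2 * M + e \<in> t" by auto
    have nr: "2 * M + e \<noteq> r k" for k using r_lt[of k] by simp
    from B_cases[OF t(1)] obtain j where j: "t = ct j" using t(2) nr by (auto simp: rt_def)
    then have "cap j = cap (2 * 0 + int e)" using t(2) nr unfolding ce by (auto simp: ct_def)
    then have "even j \<longleftrightarrow> e = 0" using e by (auto simp: cap_eq)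
    then have "j = 2 * (j div 2) + int e" using e by (cases "e = 0") auto
    then have "t = ?f (nat (j div 2 mod int M))" using ct j by metis
    moreover have "nat (j div 2 mod int M) < M" using M by (simp add: nat_less_iff)
    ultimately show "t \<in> ?f ` {..<M}" by blast
  next
    fix t assume "t \<in> ?f ` {..<M}"
    then obtain i where i: "i < M" "t = ?f i" by blast
    then have "t = ct (2 * int i + int e)" unfolding ct by simp
    then show "t \<in> {t \<in> B. 2 * M + e \<in> t}" using ct_B i(2) by auto
  qed
  moreover have "inj_on (\<lambda>i. 2 * i + e) {..<M}" by (auto simp: inj_on_def)
  moreover have "2 * M + e \<notin> (\<lambda>i. 2 * i + e) ` {..<M}" by auto
  ultimately show ?thesis unfolding link_cycle_def by blast
qed

section \<open>Coordinates of the barrel\<close>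

definition \<theta> :: real where "\<theta> = pi / real M"

text \<open>The angle is folded into the interval from 0 to \<open>pi\<close>, where the cosine is
  injective; \<open>f\<close> is the cyclic distance of \<open>d\<close> from 0 modulo
  \<open>2 * M\<close>.\<close>

lemma cos_ring:
  obtains f :: nat where "cos (real_of_int d * \<theta>) = cos (real f * \<theta>)" "f \<le> M" "even f \<longleftrightarrow> even d"
    "f = 0 \<longleftrightarrow> r d = r 0" "f = 1 \<longleftrightarrow> r d = r 1 \<or> r d = r (-1)"
proof -
  define e where "e = r d"
  have e: "e < 2 * M" by (simp add: e_def r_lt)
  have ed: "r (int e) = r d" using r_int[OF e] by (simp add: e_def)
  then have "2 * int M dvd d - int e" using r_iff[of d "int e"] by simp
  then obtain q where "d - int e = 2 * int M * q" by blast
  then have d: "d = int e + 2 * int M * q" by simp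
  have M0: "real M \<noteq> 0" using M by simp
  have "real_of_int d * \<theta> = real e * \<theta> + 2 * pi * real_of_int q"
    unfolding d \<theta>_def using M0 by (simp add: field_simps)
  then have cd: "cos (real_of_int d * \<theta>) = cos (real e * \<theta>)"
    using cos_int_2pin[of q] sin_int_2pin[of q] by (simp add: cos_add)
  have par: "even e \<longleftrightarrow> even d" unfolding d by simp
  have r1: "r d = r 0 \<longleftrightarrow> e = 0" "r d = r 1 \<longleftrightarrow> e = 1" "r d = r (-1) \<longleftrightarrow> e = 2 * M - 1"
  proof -
    have "r 0 = 0" "r 1 = 1" using r_int[of 0] r_int[of 1] M by simp_all
    moreover have "r (-1) = 2 * M - 1"
    proof -
      have "r (-1) = r (int (2 * M - 1))" unfolding r_iff using M by (auto simp: of_nat_diff)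
      then show ?thesis using r_int[of "2 * M - 1"] M by simp
    qed
    ultimately show "r d = r 0 \<longleftrightarrow> e = 0" "r d = r 1 \<longleftrightarrow> e = 1" "r d = r (-1) \<longleftrightarrow> e = 2 * M - 1"
      unfolding e_def by simp_all
  qed
  show thesis
  proof (cases "e \<le> M")
    case True
    show thesis by (rule that[of e]) (use True cd par r1 M in auto)
  next
    case False
    have "real (2 * M - e) * \<theta> = 2 * pi - real e * \<theta>"
      using e M0 by (simp add: \<theta>_def of_nat_diff field_simps)
    then have "cos (real e * \<theta>) = cos (real (2 * M - e) * \<theta>)" by (simp add: cos_diff)
    then show thesis
      by (intro that[of "2 * M - e"]) (use False e cd par r1 M in auto)
  qed
qed

lemma cos_odd:
  assumes "odd d"
  shows "cos (real_of_int d * \<theta>) \<le> cos \<theta>"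
    and "cos (real_of_int d * \<theta>) = cos \<theta> \<longleftrightarrow> r d = r 1 \<or> r d = r (-1)"
proof -
  obtain f where f: "cos (real_of_int d * \<theta>) = cos (real f * \<theta>)" "f \<le> M" "odd f"
    "f = 1 \<longleftrightarrow> r d = r 1 \<or> r d = r (-1)" using cos_ring[of d] assms by metis
  have f1: "1 \<le> f" using f(3) by (cases f) auto
  have b: "0 \<le> real f * \<theta>" "real f * \<theta> \<le> pi" "0 \<le> \<theta>" "\<theta> \<le> pi" "\<theta> > 0"
    using f(2) M by (auto simp: \<theta>_def divide_simps)
  show "cos (real_of_int d * \<theta>) \<le> cos \<theta>"
    unfolding f(1) using b f1 by (subst cos_mono_le_eq) auto
  have "cos (real f * \<theta>) = cos \<theta> \<longleftrightarrow> real f * \<theta> = \<theta>" using cos_inj_pi[of "real f * \<theta>" \<theta>] b by auto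
  also have "\<dots> \<longleftrightarrow> f = 1" using b(5) by auto
  finally show "cos (real_of_int d * \<theta>) = cos \<theta> \<longleftrightarrow> r d = r 1 \<or> r d = r (-1)"
    using f(1,4) by simp
qed

lemma cos_even: "cos (real_of_int d * \<theta>) = 1 \<longleftrightarrow> r d = r 0"
proof -
  obtain f where f: "cos (real_of_int d * \<theta>) = cos (real f * \<theta>)" "f \<le> M"
    "f = 0 \<longleftrightarrow> r d = r 0" using cos_ring[of d] by metis
  have b: "0 \<le> real f * \<theta>" "real f * \<theta> \<le> pi" "\<theta> > 0"
    using f(2) M by (auto simp: \<theta>_def divide_simps)
  have "cos (real f * \<theta>) = cos 0 \<longleftrightarrow> real f * \<theta> = 0" using b cos_inj_pi[of "real f * \<theta>" 0] by auto
  then show ?thesis using f(1,3) b(3) by simp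
qed

text \<open>The ring facets have normals \<open>(cos k\<theta>, sin k\<theta>, \<plusminus>1)\<close>. A vertex between \<open>r j\<close> and
  \<open>r (j + 2)\<close> points in direction \<open>(j + 1)\<theta>\<close>; its radius and height are determined by the tight facets.\<close>

lemma realizable_B: "realizable B"
proof -
  define C where "C = cos \<theta>"
  have \<theta>: "0 < \<theta>" "\<theta> \<le> pi / 6" using M by (auto simp: \<theta>_def divide_simps)
  have C1: "C < 1" using \<theta> cos_monotone_0_pi[of 0 \<theta>] by (simp add: C_def)
  have "sqrt 3 / 2 \<le> C" using \<theta> cos_monotone_0_pi_le[of \<theta> "pi / 6"] by (simp add: C_def cos_30)
  moreover have "sqrt 3 > 1" by simp
  ultimately have C0: "C > 1 / 2" by linarith
  \<comment> \<open>A vertex of \<open>rt j\<close> with radius \<open>S\<close> and height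
    \<open>z\<close> must satisfy \<open>S * C + z = 1\<close> for the two facets of one ring and
    \<open>S - z = 1\<close> for the facet of the other. The solution is
    \<open>S = 1 + \<tau>\<close>, \<open>z = \<tau>\<close>.\<close>
  define \<tau> where "\<tau> = (1 - C) / (1 + C)"
  have \<tau>: "0 < \<tau>" "\<tau> < 1 / 2" "(1 + \<tau>) * C = 1 - \<tau>" using C0 C1 by (auto simp: \<tau>_def field_simps)
  \<comment> \<open>The caps are placed at heights \<open>2 * \<tau>\<close> and
    \<open>- 2 * \<tau>\<close>, beyond all vertices of the previous kind. The equation
    \<open>\<rho> * C + 2 * \<tau> = 1\<close> puts the vertices of a cap on their two
    pentagons.\<close>
  define \<rho> where "\<rho> = (1 - 2 * \<tau>) / C"
  have \<rho>: "\<rho> > 0" "\<rho> * C = 1 - 2 * \<tau>" using C0 \<tau> by (auto simp: \<rho>_def)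
  \<comment> \<open>The aim is \<open>\<rho> < 1 + 2 * \<tau>\<close>: the vertices on one cap
    satisfy the inequalities of the other ring strictly.\<close>
  have "(1 + 2 * \<tau>) * (1 - \<tau>) > (1 - 2 * \<tau>) * (1 + \<tau>)" using \<tau>(1) by (simp add: algebra_simps)
  then have "(1 + 2 * \<tau>) * C * (1 + \<tau>) > (1 - 2 * \<tau>) * (1 + \<tau>)" unfolding \<tau>(3)[symmetric] by (simp add: algebra_simps)
  then have "(1 + 2 * \<tau>) * C > 1 - 2 * \<tau>" using \<tau>(1) by simp
  then have \<rho>2: "\<rho> < 1 + 2 * \<tau>" using C0 by (simp add: \<rho>_def field_simps)
  define \<sigma> :: "int \<Rightarrow> real" where "\<sigma> j = (if even j then 1 else - 1)" for j
  define a :: "nat \<Rightarrow> real^3" where "a i = (if i < 2 * M then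
      vector [cos (real i * \<theta>), sin (real i * \<theta>), \<sigma> (int i)] else vector [0, 0, if i = 2 * M then 1 else - 1])" for i
  define b :: "nat \<Rightarrow> real" where "b i = (if i < 2 * M then 1 else 2 * \<tau>)" for i
  define pt :: "real \<Rightarrow> real \<Rightarrow> int \<Rightarrow> real^3" where
    "pt S z j = vector [S * cos (real_of_int (j + 1) * \<theta>), S * sin (real_of_int (j + 1) * \<theta>), \<sigma> j * z]" for S z j
  have ring: "a (r k) \<bullet> pt S z j = S * cos (real_of_int (k - (j + 1)) * \<theta>) + \<sigma> k * \<sigma> j * z" "b (r k) = 1" for k S z j
  proof -
    \<comment> \<open>\<open>k\<close> and \<open>r k\<close> differ by a multiple of
      \<open>2 * M\<close>, so their angles differ by full turns.\<close>
    have "r (k - int (r k)) = r 0" using r_iff[of "k - int (r k)" 0] r_iff[of k "int (r k)"] r_int[OF r_lt] by simp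
    then have "cos (real_of_int (k - int (r k)) * \<theta>) = 1" using cos_even by blast
    then obtain q :: int where q: "real_of_int (k - int (r k)) * \<theta> = real_of_int q * 2 * pi"
      using cos_one_2pi_int by auto
    then have "real (r k) * \<theta> = real_of_int k * \<theta> - 2 * pi * real_of_int q" by (simp add: algebra_simps)
    then have "cos (real (r k) * \<theta>) = cos (real_of_int k * \<theta>)" "sin (real (r k) * \<theta>) = sin (real_of_int k * \<theta>)"
      using cos_int_2pin[of q] sin_int_2pin[of q] by (simp_all add: cos_diff sin_diff)
    moreover have "\<sigma> (int (r k)) = \<sigma> k"
      using r_even[of "int (r k)" k] r_int[OF r_lt] by (simp add: \<sigma>_def)
    ultimately show "a (r k) \<bullet> pt S z j = S * cos (real_of_int (k - (j + 1)) * \<theta>) + \<sigma> k * \<sigma> j * z"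
      using r_lt[of k]
      by (simp add: a_def pt_def inner_vec_def sum_3 left_diff_distrib cos_diff algebra_simps)
    show "b (r k) = 1" using r_lt[of k] by (simp add: b_def)
  qed
  have caps: "a (cap k) \<bullet> pt S z j = \<sigma> k * \<sigma> j * z" "b (cap k) = 2 * \<tau>" for k S z j
    by (auto simp: a_def b_def pt_def cap_def \<sigma>_def inner_vec_def sum_3)
  \<comment> \<open>Seen from direction \<open>j + 1\<close>, the facets in the ring of
    \<open>j\<close> lie at odd multiples of \<open>\<theta>\<close> and the others at even
    multiples; the largest cosines are \<open>C\<close> and 1 respectively.\<close>
  have same: "S * cos (real_of_int (k - (j + 1)) * \<theta>) \<le> S * C"
    "S * cos (real_of_int (k - (j + 1)) * \<theta>) = S * C \<longleftrightarrow> r k = r j \<or> r k = r (j + 2)"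
    if "S > 0" "even k \<longleftrightarrow> even j" for S k j
  proof -
    have "odd (k - (j + 1))" using that(2) by auto
    note c = cos_odd[OF this]
    show "S * cos (real_of_int (k - (j + 1)) * \<theta>) \<le> S * C" using c(1) that(1) by (simp add: C_def)
    have "r (k - (j + 1)) = r 1 \<longleftrightarrow> r k = r (j + 2)" "r (k - (j + 1)) = r (-1) \<longleftrightarrow> r k = r j"
      by (simp_all add: r_iff algebra_simps)
    then show "S * cos (real_of_int (k - (j + 1)) * \<theta>) = S * C \<longleftrightarrow> r k = r j \<or> r k = r (j + 2)"
      using c(2) that(1) by (auto simp: C_def)
  qed
  have opp: "S * cos (real_of_int (k - (j + 1)) * \<theta>) \<le> S"
    "S * cos (real_of_int (k - (j + 1)) * \<theta>) = S \<longleftrightarrow> r k = r (j + 1)" if "S > 0" for S k j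
  proof -
    show "S * cos (real_of_int (k - (j + 1)) * \<theta>) \<le> S" using that mult_left_mono[OF cos_le_one, of S] by simp
    have "r (k - (j + 1)) = r 0 \<longleftrightarrow> r k = r (j + 1)" by (simp add: r_iff)
    then show "S * cos (real_of_int (k - (j + 1)) * \<theta>) = S \<longleftrightarrow> r k = r (j + 1)"
      using cos_even[of "k - (j + 1)"] that by simp
  qed
  have \<sigma>\<sigma>: "\<sigma> k * \<sigma> j = (if even k \<longleftrightarrow> even j then 1 else - 1)" for k j by (simp add: \<sigma>_def)
  have "\<forall>i\<in>\<Union>B. a i \<bullet> pt (1 + \<tau>) \<tau> j \<le> b i \<and> (a i \<bullet> pt (1 + \<tau>) \<tau> j = b i \<longleftrightarrow> i \<in> rt j)" for j
  proof
    fix i assume "i \<in> \<Union>B"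
    then consider k where "i = r k" | k where "i = cap k" using mem_B by blast
    then show "a i \<bullet> pt (1 + \<tau>) \<tau> j \<le> b i \<and> (a i \<bullet> pt (1 + \<tau>) \<tau> j = b i \<longleftrightarrow> i \<in> rt j)"
    proof cases
      case (1 k)
      show ?thesis
      proof (cases "even k \<longleftrightarrow> even j")
        case True
        then have "r k \<noteq> r (j + 1)" using r_even[of k "j + 1"] by auto
        define Q where "Q = (1 + \<tau>) * cos (real_of_int (k - (j + 1)) * \<theta>)"
        have "Q \<le> 1 - \<tau>" "Q = 1 - \<tau> \<longleftrightarrow> r k = r j \<or> r k = r (j + 2)"
          using same[of "1 + \<tau>" k j] True \<tau> unfolding Q_def by simp_all
        then show ?thesis unfolding 1 ring \<sigma>\<sigma> rt_def Q_def[symmetric]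
          using \<open>r k \<noteq> r (j + 1)\<close> True by auto
      next
        case False
        then have "r k \<noteq> r j" "r k \<noteq> r (j + 2)" using r_even[of k j] r_even[of k "j + 2"] by auto
        define Q where "Q = (1 + \<tau>) * cos (real_of_int (k - (j + 1)) * \<theta>)"
        have "Q \<le> 1 + \<tau>" "Q = 1 + \<tau> \<longleftrightarrow> r k = r (j + 1)"
          using opp[of "1 + \<tau>" k j] \<tau>(1) unfolding Q_def by (smt (verit))+
        then show ?thesis unfolding 1 ring \<sigma>\<sigma> rt_def Q_def[symmetric]
          using \<open>r k \<noteq> r j\<close> \<open>r k \<noteq> r (j + 2)\<close> False by auto
      qed
    next
      case (2 k)
      then show ?thesis unfolding 2 caps \<sigma>\<sigma> rt_def using \<tau> by auto
    qed
  qed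
  moreover have "\<forall>i\<in>\<Union>B. a i \<bullet> pt \<rho> (2 * \<tau>) j \<le> b i \<and> (a i \<bullet> pt \<rho> (2 * \<tau>) j = b i \<longleftrightarrow> i \<in> ct j)" for j
  proof
    fix i assume "i \<in> \<Union>B"
    then consider k where "i = r k" | k where "i = cap k" using mem_B by blast
    then show "a i \<bullet> pt \<rho> (2 * \<tau>) j \<le> b i \<and> (a i \<bullet> pt \<rho> (2 * \<tau>) j = b i \<longleftrightarrow> i \<in> ct j)"
    proof cases
      case (1 k)
      show ?thesis
      proof (cases "even k \<longleftrightarrow> even j")
        case True
        define Q where "Q = \<rho> * cos (real_of_int (k - (j + 1)) * \<theta>)"
        have "Q \<le> 1 - 2 * \<tau>" "Q = 1 - 2 * \<tau> \<longleftrightarrow> r k = r j \<or> r k = r (j + 2)"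
          using same[of \<rho> k j] True \<rho> unfolding Q_def by simp_all
        then show ?thesis unfolding 1 ring \<sigma>\<sigma> ct_def Q_def[symmetric] using True by auto
      next
        case False
        then have "r k \<noteq> r j" "r k \<noteq> r (j + 2)" using r_even[of k j] r_even[of k "j + 2"] by auto
        define Q where "Q = \<rho> * cos (real_of_int (k - (j + 1)) * \<theta>)"
        have "Q < 1 + 2 * \<tau>" using opp(1)[of \<rho> k j] \<rho>(1) \<rho>2 unfolding Q_def by linarith
        then show ?thesis unfolding 1 ring \<sigma>\<sigma> ct_def Q_def[symmetric]
          using \<open>r k \<noteq> r j\<close> \<open>r k \<noteq> r (j + 2)\<close> False by auto
      qed
    next
      case (2 k)
      then show ?thesis unfolding 2 caps \<sigma>\<sigma> ct_def using \<tau> by (auto simp: cap_eq)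
    qed
  qed
  ultimately have "\<exists>x. \<forall>i\<in>\<Union>B. a i \<bullet> x \<le> b i \<and> (a i \<bullet> x = b i \<longleftrightarrow> i \<in> t)" if "t \<in> B" for t
    using B_cases[OF that] by metis
  then show ?thesis unfolding realizable_def by (intro exI[of _ a] exI[of _ b] ballI)
qed

end

subsection \<open>Dividing the bases of a barrel\<close>

text \<open>The facet being divided is left out because its size changes with every cut.\<close>

definition count_deg :: "nat set set \<Rightarrow> nat \<Rightarrow> nat \<Rightarrow> nat" where
  "count_deg T F k = card {i \<in> \<Union>T - {F}. deg T i = k}"

text \<open>The top \<open>F\<close> of a barrel is cut into a strip of facets. The next cut goes from \<open>G 0\<close> over the
  last facet \<open>G 2\<close> of the strip to some \<open>G j\<close> with \<open>j \<ge> 4\<close>; its two ends have to be pentagons,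
  as they become hexagons.\<close>

definition strip :: "nat set set \<Rightarrow> nat \<Rightarrow> nat \<Rightarrow> (nat \<Rightarrow> nat) \<Rightarrow> bool" where
  "strip T F m G \<longleftrightarrow> pogorelov_complex T \<and> realizable T \<and> link_cycle T F m G \<and> deg T (G 0) = 5 \<and>
     (\<forall>j. 4 \<le> j \<and> j < m \<longrightarrow> deg T (G j) = 5)"

text \<open>The bottom \<open>E\<close> of the barrel and its pentagonal neighbours are not affected by cuts of \<open>F\<close>.\<close>

definition far :: "nat set set \<Rightarrow> nat \<Rightarrow> nat \<Rightarrow> (nat \<Rightarrow> nat) \<Rightarrow> nat \<Rightarrow> nat \<Rightarrow> (nat \<Rightarrow> nat) \<Rightarrow> bool" where
  "far T F m G E M H \<longleftrightarrow> 0 < M \<and> link_cycle T E M H \<and> E \<noteq> F \<and> E \<notin> G ` {..<m} \<and> F \<notin> H ` {..<M} \<and>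
     G ` {..<m} \<inter> H ` {..<M} = {} \<and> (\<forall>j<M. deg T (H j) = 5)"

lemma card_Un_if:
  "finite A \<Longrightarrow> x \<notin> A \<Longrightarrow> card (A \<union> (if Q then {x} else {})) = card A + (if Q then 1 else 0)"
  by simp

lemma link_cycle_Union:
  assumes "link_cycle T F m G" "0 < m"
  shows "F \<in> \<Union>T" "G ` {..<m} \<subseteq> \<Union>T"
proof -
  have "{F, G i, G (Suc i mod m)} \<in> T" if "i < m" for i
    using assms(1) that unfolding link_cycle_def by blast
  then show "F \<in> \<Union>T" "G ` {..<m} \<subseteq> \<Union>T" using assms(2) by blast+
qed

text \<open>The two ends pass from 5 to 6 sides, so above 6 the count changes only through the new
  facet.\<close>

lemma cut_step:
  assumes "pogorelov_complex T" "realizable T" "link_cycle T F m G" "2 \<le> s" "s + 4 \<le> m"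
    and deg0: "deg T (G 0) = 5" and degj: "\<And>j. s < j \<Longrightarrow> j < m \<Longrightarrow> deg T (G j) = 5"
  shows "\<exists>T' G'. strip T' F (m - s + 1) G' \<and>
     (\<forall>k\<ge>7. count_deg T' F k = count_deg T F k + (if k = s + 3 then 1 else 0)) \<and>
     (\<forall>E M H. far T F m G E M H \<longrightarrow> far T' F (m - s + 1) G' E M H)"
proof -
  have fin: "finite (\<Union>T)"
    using pog_finite[OF assms(1)] pog_card[OF assms(1)] by (metis card.infinite finite_Union zero_neq_numeral)
  then obtain N where N: "N \<notin> \<Union>T" using ex_new_if_finite infinite_UNIV_nat by blast
  interpret cut T F m G s N by unfold_locales (use assms N in auto)
  have G'_def': "G' 0 = G (m - 1)" "G' 1 = G 0" "G' 2 = N" "\<And>j. 3 \<le> j \<Longrightarrow> G' j = G (s + j - 2)"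
    by (simp_all add: G'_def)
  have kept: "deg T' x = deg T x" if "x \<noteq> N" "x \<noteq> F" "x \<noteq> G 0" "x \<noteq> G (Suc s)" for x
    using deg'_old[of x] that by simp
  have strip: "strip T' F (m - s + 1) G'"
    unfolding strip_def
  proof (intro conjI allI impI)
    \<comment> \<open>In the new enumeration the two hexagons stand at positions 1 and 3 and
      \<open>N\<close> at 2; position 0 and those from 4 on are pentagons that the cut did not
      touch.\<close>
    have keptG: "deg T' (G j) = 5" if "Suc s < j" "j < m" for j
      using kept[of "G j"] degj[of j] N_G[of j] G_F[of j] G_eq[of j 0] G_eq[of j "Suc s"] that by simp
    show "deg T' (G' 0) = 5" using keptG[of "m - 1"] sm by (simp add: G'_def')
    show "deg T' (G' j) = 5" if "4 \<le> j \<and> j < m - s + 1" for j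
    proof -
      have "Suc s < s + j - 2" "s + j - 2 < m" using that sm by linarith+
      then show ?thesis using keptG that by (simp add: G'_def')
    qed
  qed (use pog' link' realizable_cut assms(2) in auto)
  have "count_deg T' F k = count_deg T F k + (if k = s + 3 then 1 else 0)" if k: "7 \<le> k" for k
  proof -
    have "{i \<in> \<Union>T' - {F}. deg T' i = k} =
        {i \<in> \<Union>T - {F}. deg T i = k} \<union> (if k = s + 3 then {N} else {})"
    proof -
      have "deg T' i = k \<longleftrightarrow> deg T i = k" if "i \<in> \<Union>T - {F}" for i
      proof (cases "i = G 0 \<or> i = G (Suc s)")
        case True
        then have "deg T i = 5" using deg0 degj[of "Suc s"] sm by auto
        moreover have "i \<noteq> N" "i \<noteq> F" using that N by blast+
        then have "deg T' i = deg T i + 1" using deg'_old[of i] True by simp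
        ultimately show ?thesis using k by simp
      next
        case False
        moreover have "i \<noteq> N" "i \<noteq> F" using that N by blast+
        ultimately show ?thesis using kept[of i] by simp
      qed
      then show ?thesis unfolding Union' using deg'_N N N_F by auto
    qed
    moreover have "finite {i \<in> \<Union>T - {F}. deg T i = k}" using fin by (rule rev_finite_subset) blast
    moreover have "N \<notin> {i \<in> \<Union>T - {F}. deg T i = k}" using N by blast
    ultimately show ?thesis unfolding count_deg_def by (simp only: card_Un_if not_False_eq_True)
  qed
  moreover have "far T' F (m - s + 1) G' E M H" if "far T F m G E M H" for E M H
  proof -
    have h: "0 < M" "link_cycle T E M H" "E \<noteq> F" "E \<notin> G ` {..<m}" "F \<notin> H ` {..<M}"
      "G ` {..<m} \<inter> H ` {..<M} = {}" "\<And>j. j < M \<Longrightarrow> deg T (H j) = 5"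
      using that unfolding far_def by blast+
    have EH: "E \<noteq> N" "N \<notin> H ` {..<M}" using link_cycle_Union[OF h(2,1)] N by blast+
    have G': "G' ` {..<m - s + 1} \<subseteq> insert N (G ` {..<m})"
    proof
      fix x assume "x \<in> G' ` {..<m - s + 1}"
      then obtain j where "j < m - s + 1" "x = G' j" by blast
      then show "x \<in> insert N (G ` {..<m})" using sm by (auto simp: G'_def)
    qed
    have "deg T' (H j) = 5" if "j < M" for j
    proof -
      have "H j \<noteq> N" "H j \<noteq> F" using EH(2) h(5) that by blast+
      moreover have "H j \<noteq> G i" if "i < m" for i using h(6) that \<open>j < M\<close> by blast
      ultimately show ?thesis using kept[of "H j"] h(7)[OF that] sm by simp
    qed
    moreover have "link_cycle T' E M H" by (rule link_other[OF h(2-4) EH(1)])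
    moreover have "E \<notin> G' ` {..<m - s + 1}" using subsetD[OF G', of E] h(4) EH(1) by blast
    moreover have "G' ` {..<m - s + 1} \<inter> H ` {..<M} = {}"
    proof -
      have "A \<inter> C = {}" if "A \<subseteq> insert N B" "N \<notin> C" "B \<inter> C = {}" for A B C
        using that by blast
      from this[OF G' EH(2) h(6)] show ?thesis .
    qed
    ultimately show ?thesis unfolding far_def using h(1,3,5) by simp
  qed
  ultimately show ?thesis using strip by (intro exI[of _ T'] exI[of _ G']) simp
qed

text \<open>A cut with \<open>s = k - 3\<close> costs \<open>k - 4\<close> sides. From
  \<open>k \<ge> 6\<close> follows \<open>s \<ge> 3\<close>, so the far end has index at least 4 and
  avoids the hexagon left at position 3; \<open>r \<ge> 5\<close> keeps the cuts within the bound
  \<open>s + 4 \<le> m\<close>.\<close>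

lemma strip_list:
  assumes "strip T F (r + (\<Sum>k\<leftarrow>ks. k - 4)) G" "\<And>k. k \<in> set ks \<Longrightarrow> 6 \<le> k" "5 \<le> r"
  shows "\<exists>T' G'. strip T' F r G' \<and> (\<forall>k\<ge>7. count_deg T' F k = count_deg T F k + count_list ks k) \<and>
     (\<forall>E M H. far T F (r + (\<Sum>k\<leftarrow>ks. k - 4)) G E M H \<longrightarrow> far T' F r G' E M H)"
  using assms
proof (induction ks arbitrary: T G)
  case Nil
  then show ?case by (intro exI[of _ T] exI[of _ G]) simp
next
  case (Cons k ks)
  let ?m = "r + (\<Sum>k\<leftarrow>k # ks. k - 4)" and ?m' = "r + (\<Sum>k\<leftarrow>ks. k - 4)"
  have k: "6 \<le> k" using Cons.prems by simp
  have m: "?m - (k - 3) + 1 = ?m'" "k - 3 + 4 \<le> ?m" using k Cons.prems(3) by simp_all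
  have st: "pogorelov_complex T" "realizable T" "link_cycle T F ?m G" "deg T (G 0) = 5"
    "\<And>j. 4 \<le> j \<Longrightarrow> j < ?m \<Longrightarrow> deg T (G j) = 5"
    using Cons.prems(1) unfolding strip_def by blast+
  obtain T1 G1 where T1: "strip T1 F ?m' G1"
    "\<forall>l\<ge>7. count_deg T1 F l = count_deg T F l + (if l = k then 1 else 0)"
    "\<forall>E M H. far T F ?m G E M H \<longrightarrow> far T1 F ?m' G1 E M H"
    using cut_step[OF st(1-3) _ m(2) st(4)] st(5) k unfolding m(1) by (auto simp: le_diff_conv2)
  obtain T2 G2 where T2: "strip T2 F r G2"
    "\<forall>l\<ge>7. count_deg T2 F l = count_deg T1 F l + count_list ks l"
    "\<forall>E M H. far T1 F ?m' G1 E M H \<longrightarrow> far T2 F r G2 E M H"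
    using Cons.IH[OF T1(1)] Cons.prems(2,3) by auto
  have "\<forall>l\<ge>7. count_deg T2 F l = count_deg T F l + count_list (k # ks) l"
    using T1(2) T2(2) by auto
  moreover have "\<forall>E M H. far T F ?m G E M H \<longrightarrow> far T2 F r G2 E M H" using T1(3) T2(3) by blast
  ultimately show ?case using T2(1) by blast
qed

text \<open>While all neighbours are pentagons, a cut with \<open>s = 2\<close> is possible. It
  opens the strip with a pentagon, which the counts from 7 on ignore, and costs one side;
  \<open>r\<close> is the size left to \<open>F\<close> at the end.\<close>

lemma fill_link_cycle:
  assumes "pogorelov_complex T" "realizable T" "link_cycle T F (6 + (\<Sum>k\<leftarrow>ks. k - 4) + (r - 5)) G"
    "\<And>j. j < 6 + (\<Sum>k\<leftarrow>ks. k - 4) + (r - 5) \<Longrightarrow> deg T (G j) = 5"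
    "\<And>k. k \<in> set ks \<Longrightarrow> 6 \<le> k" "5 \<le> r"
  shows "\<exists>T' G'. strip T' F r G' \<and> (\<forall>k\<ge>7. count_deg T' F k = count_deg T F k + count_list ks k) \<and>
     (\<forall>E M H. far T F (6 + (\<Sum>k\<leftarrow>ks. k - 4) + (r - 5)) G E M H \<longrightarrow> far T' F r G' E M H)"
proof -
  let ?m = "6 + (\<Sum>k\<leftarrow>ks. k - 4) + (r - 5)" and ?m' = "r + (\<Sum>k\<leftarrow>ks. k - 4)"
  have m: "?m - 2 + 1 = ?m'" using assms(6) by simp
  obtain T1 G1 where T1: "strip T1 F ?m' G1" "\<forall>k\<ge>7. count_deg T1 F k = count_deg T F k"
    "\<forall>E M H. far T F ?m G E M H \<longrightarrow> far T1 F ?m' G1 E M H"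
    using cut_step[OF assms(1-3), of 2] assms(4) unfolding m by auto
  obtain T2 G2 where "strip T2 F r G2"
    "\<forall>k\<ge>7. count_deg T2 F k = count_deg T1 F k + count_list ks k"
    "\<forall>E M H. far T1 F ?m' G1 E M H \<longrightarrow> far T2 F r G2 E M H"
    using strip_list[OF T1(1) assms(5,6)] by auto
  then show ?thesis using T1(2,3) by (intro exI[of _ T2] exI[of _ G2]) auto
qed

lemma card_deg_count_deg:
  assumes "finite (\<Union>T)" "F \<in> \<Union>T"
  shows "card {i \<in> \<Union>T. deg T i = k} = count_deg T F k + (if deg T F = k then 1 else 0)"
proof -
  have "{i \<in> \<Union>T. deg T i = k} = {i \<in> \<Union>T - {F}. deg T i = k} \<union> (if deg T F = k then {F} else {})"
    using assms(2) by auto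
  moreover have "finite {i \<in> \<Union>T - {F}. deg T i = k}" using assms(1) by (rule rev_finite_subset) blast
  moreover have "F \<notin> {i \<in> \<Union>T - {F}. deg T i = k}" by blast
  ultimately show ?thesis unfolding count_deg_def by (simp only: card_Un_if not_False_eq_True)
qed

lemma list_with_counts:
  assumes "finite S"
  shows "\<exists>ks. set ks \<subseteq> S \<and> (\<forall>k\<in>S. count_list ks k = p k)"
  using assms
proof (induction S)
  case (insert x S)
  then obtain ks where ks: "set ks \<subseteq> S" "\<forall>k\<in>S. count_list ks k = p k" by blast
  have "count_list ks x = 0" using ks(1) insert(2) by (auto simp: count_list_0_iff)
  moreover have "count_list (replicate n x) k = (if k = x then n else 0)" for n k
    by (induction n) auto
  ultimately show ?case using ks insert(2)
    by (intro exI[of _ "replicate (p x) x @ ks"]) auto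
qed simp

theorem corollaryB15:
  fixes p :: "nat \<Rightarrow> nat"
  assumes "finite {k. k \<ge> 7 \<and> p k \<noteq> 0}"
  shows "\<exists>P :: (real^3) set. pogorelov_polytope P \<and> (\<forall>k\<ge>7. card (k_gonal_facets k P) = p k)"
proof -
  obtain ks where ks: "set ks \<subseteq> {k. k \<ge> 7 \<and> p k \<noteq> 0}"
    "\<forall>k\<in>{k. k \<ge> 7 \<and> p k \<noteq> 0}. count_list ks k = p k"
    using list_with_counts[OF assms] by blast
  have count: "count_list ks k = p k" if "7 \<le> k" for k
    using ks that by (cases "p k = 0") (auto simp: count_list_0_iff)
  have ks6: "6 \<le> k" if "k \<in> set ks" for k using ks(1) that by auto
  define M where "M = 6 + (\<Sum>k\<leftarrow>ks. k - 4)"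
  interpret barrel M by unfold_locales (simp add: M_def)
  define E F where "E = 2 * M + 1" and "F = 2 * M"
  have link: "link_cycle B F M (\<lambda>i. 2 * i)" "link_cycle B E M (\<lambda>i. 2 * i + 1)"
    using link_B[of 0] link_B[of 1] by (simp_all add: E_def F_def)
  have M6: "6 \<le> M" by (rule M)
  have degB: "deg B F = M" "deg B E = M" using deg_link_cycle link M6 by simp_all
  \<comment> \<open>The neighbours of the top have even labels and those of the bottom odd ones, so
    dividing the top leaves the latter pentagons.\<close>
  have far: "far B F M (\<lambda>i. 2 * i) E M (\<lambda>i. 2 * i + 1)"
    unfolding far_def using link(2) deg_ring M6 by (auto simp: E_def F_def; presburger)
  have cB: "count_deg B F k = (if k = M then 1 else 0)" if k: "7 \<le> k" for k
  proof -
    have "deg B i = k \<longleftrightarrow> i = E \<and> k = M" if "i \<in> \<Union>B - {F}" for i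
    proof (cases "i < 2 * M")
      case True
      then show ?thesis using deg_ring[OF True] k by (simp add: E_def)
    next
      case False
      then have "i = E" using that unfolding Union_B E_def F_def by auto
      then show ?thesis using degB(2) by auto
    qed
    moreover have "E \<in> \<Union>B - {F}" unfolding Union_B E_def F_def by simp
    ultimately have "{i \<in> \<Union>B - {F}. deg B i = k} = (if k = M then {E} else {})"
      by auto
    then show ?thesis by (simp add: count_deg_def)
  qed
  obtain T G where T: "strip T F 5 G"
    "\<forall>k\<ge>7. count_deg T F k = count_deg B F k + count_list ks k"
    "far T F 5 G E M (\<lambda>i. 2 * i + 1)"
    using fill_link_cycle[OF pog_B realizable_B, of F ks 5 "\<lambda>i. 2 * i"] link(1) deg_ring ks6 far
    by (auto simp: M_def[symmetric])
  have finT: "finite (\<Union>T)" if "pogorelov_complex T" for T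
    using pog_finite[OF that] pog_card[OF that] by (metis card.infinite finite_Union zero_neq_numeral)
  have T': "pogorelov_complex T" "realizable T" "link_cycle T F 5 G" using T(1) by (auto simp: strip_def)
  have TE: "link_cycle T E M (\<lambda>i. 2 * i + 1)" "\<And>j. j < M \<Longrightarrow> deg T (2 * j + 1) = 5"
    using T(3) by (auto simp: far_def)
  \<comment> \<open>The excluded facet changes from \<open>F\<close>, by now a pentagon, to
    \<open>E\<close>, still an \<open>M\<close>-gon. This removes exactly the surplus that
    \<open>E\<close> contributed in \<open>cB\<close>.\<close>
  have cT: "count_deg T E k = p k" if k: "7 \<le> k" for k
  proof -
    have "count_deg T E k + (if deg T E = k then 1 else 0) = count_deg T F k + (if deg T F = k then 1 else 0)"
    proof -
      have "E \<in> \<Union>T" "F \<in> \<Union>T"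
        using link_cycle_Union(1)[OF TE(1)] link_cycle_Union(1)[OF T'(3)] M6 by simp_all
      from this[THEN card_deg_count_deg[OF finT[OF T'(1)], of _ k]] show ?thesis by (simp only:)
    qed
    moreover have "deg T F = 5" "deg T E = M" using deg_link_cycle T'(3) TE(1) M6 by simp_all
    ultimately show ?thesis using T(2) cB count k by (auto split: if_splits)
  qed
  \<comment> \<open>The opening pentagon takes one side and each hexagon two. The remainder has 5 or
    6 sides by the parity of \<open>M\<close>, too few to be counted.\<close>
  define r where "r = 5 + M mod 2"
  define hs where "hs = replicate ((M - 6) div 2) (6 :: nat)"
  have r: "6 + (\<Sum>k\<leftarrow>hs. k - 4) + (r - 5) = M" "5 \<le> r" "r \<le> 6"
    unfolding r_def hs_def using M6 by (simp_all add: sum_list_replicate) presburger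
  have hs: "count_list hs k = 0" if "7 \<le> k" for k
    using that by (auto simp: hs_def count_list_0_iff)
  obtain U H where U: "strip U E r H" "\<forall>k\<ge>7. count_deg U E k = count_deg T E k + count_list hs k"
    using fill_link_cycle[OF T'(1,2), of E hs r "\<lambda>i. 2 * i + 1"] TE r by (auto simp: hs_def)
  have U': "pogorelov_complex U" "realizable U" "link_cycle U E r H" using U(1) by (auto simp: strip_def)
  have "card {i \<in> \<Union>U. deg U i = k} = p k" if k: "7 \<le> k" for k
  proof -
    have "deg U E = r" using deg_link_cycle U'(3) r(2) by simp
    then show ?thesis
      using card_deg_count_deg[OF finT[OF U'(1)] link_cycle_Union(1)[OF U'(3)]] U(2) cT hs k r(2,3) by simp
  qed
  moreover obtain P where "pogorelov_polytope P"
    "\<And>k. card (k_gonal_facets k P) = card {i \<in> \<Union>U. deg U i = k}"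
    using realizable_imp_polytope[OF U'(1,2)] by metis
  ultimately show ?thesis by auto
qed

end
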